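(* Let $X_1,X_2,\ldots$ be independent identically distributed random variables with $\mathsf{E}X_1=0$ and $0<\mathsf{E}X_1^2=\sigma^2<\infty$ ($\sigma>0$). Let $r>0$. For $n\in\mathbb{N}$ let $N_n^\star$ have the negative binomial distribution $$\mathsf{P}(N_n^\star=k)=\frac{\Gamma(r+k)}{\Gamma(r)\,k!}\Big(\frac{1}{1+n}\Big)^r\Big(\frac{n}{1+n}\Big)^k,\qquad k\in\mathbb{N}\cup\{0\},$$ with $N_n^\star$ independent of the sequence $X_1,X_2,\ldots$, and let $S_{N_n^\star}=X_1+\ldots+X_{N_n^\star}$ (equal to $0$ if $N_n^\star=0$). Then $$\sup_{z\ge 0}\Big|Q_{S_{N_n^\star}}(z)-\mathcal{V}^+_r\Big(\frac{z}{2\sigma\sqrt{n}}\Big)\Big|\le\frac{7.4184}{\sigma^2\,\Gamma(r)}\bigg\{\mathsf{E}\Big[X_1^2\,\gamma\Big(r,\frac{X_1^2}{n\sigma^2}\Big)\Big]+\frac{1}{\sigma\sqrt{n}}\,\mathsf{E}\Big[|X_1|^3\,\Gamma\Big(r-\frac12,\frac{X_1^2}{n\sigma^2}\Big)\Big]\bigg\}.$$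
   Context: The concentration function of a random variable $\xi$ is $Q_\xi(z)=\sup_{x\in\mathbb{R}}\mathsf{P}(x\le\xi\le x+z)$, $z\ge 0$. $\Phi$ is the standard normal distribution function, and the folded normal distribution function is $\Phi_0(x)=2\Phi(x)-1$ for $x\ge 0$, $\Phi_0(x)=0$ for $x<0$. The folded symmetric variance-gamma distribution function with shape parameter $r>0$ is $$\mathcal{V}^+_r(x)=\frac{1}{\Gamma(r)}\int_0^\infty\Phi_0\Big(\frac{x}{\sqrt{\lambda}}\Big)\lambda^{r-1}e^{-\lambda}\,d\lambda,\qquad x\in\mathbb{R}.$$ The incomplete gamma functions are $\Gamma(\alpha,z)=\int_z^\infty y^{\alpha-1}e^{-y}\,dy$ (upper; for $z>0$ the integral converges for every real $\alpha$) and $\gamma(\alpha,z)=\int_0^z y^{\alpha-1}e^{-y}\,dy$ (lower, $\alpha>0$), and $\Gamma(\alpha)=\Gamma(\alpha,0)$ for $\alpha>0$. On the event $X_1=0$ the quantity $|X_1|^3\,\Gamma(r-\frac12,\frac{X_1^2}{n\sigma^2})$ is understood as $0$. *)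

theory Defs
  imports "HOL-Probability.Probability"
begin

definition conc_fun :: "'a measure \<Rightarrow> ('a \<Rightarrow> real) \<Rightarrow> real \<Rightarrow> real" where
  "conc_fun M \<xi> z = (SUP x. measure M {\<omega> \<in> space M. x \<le> \<xi> \<omega> \<and> \<xi> \<omega> \<le> x + z})"

definition folded_normal_cdf :: "real \<Rightarrow> real" where
  "folded_normal_cdf x = (if 0 \<le> x then 2 * cdf std_normal_distribution x - 1 else 0)"

definition folded_variance_gamma_cdf :: "real \<Rightarrow> real \<Rightarrow> real" where
  "folded_variance_gamma_cdf r x =
     1 / Gamma r *
     (LINT l:{0<..}|lborel. folded_normal_cdf (x / sqrt l) * l powr (r - 1) * exp (- l))"

text \<open>
  For \<open>z > 0\<close> the integral converges for every real \<open>\<alpha>\<close>. For \<open>z = 0\<close> and \<open>\<alpha> \<le> 0\<close> it diverges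
  and the Bochner integral has the default value \<open>0\<close>.
\<close>
definition upper_inc_Gamma :: "real \<Rightarrow> real \<Rightarrow> real" where
  "upper_inc_Gamma \<alpha> z = (LINT y:{z..}|lborel. y powr (\<alpha> - 1) * exp (- y))"

definition lower_inc_Gamma :: "real \<Rightarrow> real \<Rightarrow> real" where
  "lower_inc_Gamma \<alpha> z = (LINT y:{0..z}|lborel. y powr (\<alpha> - 1) * exp (- y))"

text \<open>
  \<^const>\<open>prob_space.indep_var\<close> forces both random variables to take values in the same type. This is
  its analogue for two value types, so that a natural number can be independent of
  a whole sequence.
\<close>
definition (in prob_space) indep_var2 ::
    "'b measure \<Rightarrow> ('a \<Rightarrow> 'b) \<Rightarrow> 'c measure \<Rightarrow> ('a \<Rightarrow> 'c) \<Rightarrow> bool" where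
  "indep_var2 Ma A Mb B \<longleftrightarrow>
     random_variable Ma A \<and> random_variable Mb B \<and>
     indep_set {A -` S \<inter> space M | S. S \<in> sets Ma} {B -` S \<inter> space M | S. S \<in> sets Mb}"

end

theory Submission
  imports Defs
begin

text \<open>
  Given a Gamma distributed variable \<open>l\<close> with shape \<open>r\<close>, let \<open>N\<close> be Poisson with mean \<open>n l\<close>;
  then \<open>N\<close> is negative binomial, so the random sum is a mixture of compound Poisson
  variables. A compound Poisson variable \<open>W\<close> with rate \<open>\<lambda>\<close> and centred jumps \<open>Y\<close>, normalised to
  variance 1, satisfies \<open>E[W f(W)] = \<lambda> E[Y f(W + Y)] = \<lambda> E[Y (f(W + Y) - f(W))]\<close> with \<open>W\<close> and \<open>Y\<close>
  independent. For clamped linear \<open>f\<close> this is a concentration inequality for \<open>W\<close>; for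
  the solution \<open>f\<close> of Stein's equation of a half-line it gives, with the help of that
  inequality, \<open>\<bar>P(W \<le> z) - \<Phi>(z)\<bar> \<le> 7/2 \<lambda> E[min(Y\<^sup>2, \<bar>Y\<bar>\<^sup>3)]\<close>. Interval probabilities are thus
  approximated with constant \<open>7 < 7.4184\<close>, uniformly in the position of the interval, and
  averaging over \<open>l\<close> turns the truncated moments into incomplete Gamma functions. Among
  all intervals of length \<open>z\<close> the centred one has the largest normal probability for every \<open>l\<close>,
  which identifies the limit of the concentration functions.
\<close>

subsection \<open>The normal distribution function and Stein's equation\<close>

text \<open>Poisson counts are what makes the Palm identity exact: for a fixed number of summands
  its right side would involve one summand less, whereas the Poisson size bias restores the missing
  one, so the law of \<open>W\<close> stands on both sides.

  The obstacle is that the derivative of the Stein solution jumps at \<open>z\<close>. The Taylor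
  remainder therefore contains the probability that \<open>W\<close> falls into an interval of
  length |y|, which has to be controlled before any normal approximation is known.

  Only second moments of the jumps are available. For |y| > 1 the Taylor bound is replaced by a
  Lipschitz bound, and this is how min(y^2, |y|^3) arises. With y = X / (\<sigma> sqrt(n l)) the
  change of regime |y| = 1 happens at l = X^2 / (n \<sigma>^2), the argument of both incomplete
  Gamma functions.

  The constant 7/2 is 3/2 + 1 + 1: the smooth part of the remainder, the length of the interval in
  the concentration inequality, and the additive term of that inequality. The two endpoints of an
  interval double it.\<close>

abbreviation Phi :: "real \<Rightarrow> real" where
  "Phi \<equiv> cdf std_normal_distribution"

interpretation std_normal: real_distribution std_normal_distribution
  by (rule real_dist_normal_dist)

lemma std_normal_density_le_half: "std_normal_density x \<le> 1 / 2"
proof -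
  have "2 \<le> sqrt (2 * pi)"
    using pi_gt3 by (intro real_le_rsqrt) simp
  then have "1 / sqrt (2 * pi) \<le> 1 / 2"
    by (intro divide_left_mono) auto
  moreover have "exp (- x\<^sup>2 / 2) \<le> 1" by simp
  ultimately have "1 / sqrt (2 * pi) * exp (- x\<^sup>2 / 2) \<le> 1 / 2 * 1"
    by (intro mult_mono) auto
  then show ?thesis by (simp add: std_normal_density_def)
qed

lemma std_normal_density_ge_quarter:
  assumes "\<bar>x\<bar> \<le> 1 / 2"
  shows "1 / 4 \<le> std_normal_density x"
proof -
  have "\<bar>x\<bar>\<^sup>2 \<le> (1 / 2)\<^sup>2"
    using assms by (intro power_mono) auto
  then have "7 / 8 \<le> 1 + - x\<^sup>2 / 2" by (simp add: power_divide)
  also have "\<dots> \<le> exp (- x\<^sup>2 / 2)" by (rule exp_ge_add_one_self)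
  finally have e: "7 / 8 \<le> exp (- x\<^sup>2 / 2)" .
  have "sqrt (2 * pi) \<le> 3"
    using pi_less_4 by (intro real_le_lsqrt) auto
  then have s: "1 / 3 \<le> 1 / sqrt (2 * pi)"
    by (intro divide_left_mono) auto
  have "1 / 4 \<le> 1 / 3 * (7 / 8 :: real)" by simp
  also have "\<dots> \<le> 1 / sqrt (2 * pi) * exp (- x\<^sup>2 / 2)"
    using e s by (intro mult_mono) auto
  finally show ?thesis by (simp only: std_normal_density_def)
qed

lemma std_normal_density_uminus: "std_normal_density (- x) = std_normal_density x"
  by (simp add: std_normal_density_def)

lemma std_normal_density_has_derivative:
  "(std_normal_density has_real_derivative - x * std_normal_density x) (at x)"
  unfolding std_normal_density_def
  by (rule derivative_eq_intros refl | simp)+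

lemma continuous_on_std_normal_density: "continuous_on A std_normal_density"
  unfolding std_normal_density_def by (intro continuous_intros) auto

lemma Phi_diff_eq_integral:
  assumes "a \<le> b"
  shows "Phi b - Phi a = integral {a..b} std_normal_density"
proof (cases "a = b")
  case False
  with assms have "a < b" by simp
  have int: "set_integrable lborel {a..b} std_normal_density"
    by (intro borel_integrable_atLeastAtMost' continuous_on_std_normal_density)
  have "Phi b - Phi a = measure std_normal_distribution {a<..b}"
    by (rule std_normal.cdf_diff_eq) fact
  also have "\<dots> = (\<integral>u. indicator {a<..b} u \<partial>std_normal_distribution)"
    by simp
  also have "\<dots> = (\<integral>u. std_normal_density u *\<^sub>R indicator {a<..b} u \<partial>lborel)"
    by (intro integral_density) auto
  also have "\<dots> = (LINT u:{a..b}|lborel. std_normal_density u)"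
    unfolding set_lebesgue_integral_def
  proof (rule integral_cong_AE)
    show "AE u in lborel. std_normal_density u *\<^sub>R indicator {a<..b} u
        = indicat_real {a..b} u *\<^sub>R std_normal_density u"
      using AE_lborel_singleton[of a] by eventually_elim (auto simp: indicator_def)
  qed auto
  also have "\<dots> = integral {a..b} std_normal_density"
    by (rule set_borel_integral_eq_integral(2)[OF int])
  finally show ?thesis .
qed simp

lemma DERIV_transform_eventually:
  assumes "(g has_real_derivative D) (at x)" and "\<forall>\<^sub>F t in nhds x. f t = g t"
  shows "(f has_real_derivative D) (at x)"
  using DERIV_cong_ev[of x x f g D D] assms by simp

lemma Phi_has_derivative: "(Phi has_real_derivative std_normal_density x) (at x)"
proof -
  let ?a = "x - 1" and ?b = "x + 1"
  let ?I = "\<lambda>t. integral {?a..t} std_normal_density"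
  have "(?I has_real_derivative std_normal_density x) (at x within {?a..?b})"
    by (intro integral_has_real_derivative continuous_on_std_normal_density) simp
  then have "((\<lambda>t. Phi ?a + ?I t) has_real_derivative std_normal_density x) (at x within {?a..?b})"
    by (auto intro!: derivative_eq_intros)
  then have "((\<lambda>t. Phi ?a + ?I t) has_real_derivative std_normal_density x) (at x)"
    by (subst (asm) at_within_interior) auto
  moreover have "\<forall>\<^sub>F t in nhds x. t \<in> {?a<..<?b}"
    by (rule eventually_nhds_in_open) auto
  then have "\<forall>\<^sub>F t in nhds x. Phi t = Phi ?a + ?I t"
  proof eventually_elim
    case (elim t)
    then show ?case using Phi_diff_eq_integral[of ?a t] by simp
  qed
  ultimately show ?thesis
    by (rule DERIV_transform_eventually)
qed

lemmas Phi_has_derivative' = DERIV_chain2[OF Phi_has_derivative]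

lemma isCont_Phi: "isCont Phi x"
  using Phi_has_derivative by (rule DERIV_isCont)

text \<open>The density is even, so \<open>Phi t + Phi (- t)\<close> has derivative 0 and is
  constant; its limit at infinity is 1 + 0.\<close>

lemma Phi_uminus: "Phi (- x) = 1 - Phi x"
proof -
  let ?h = "\<lambda>t. Phi t + Phi (- t)"
  have "(?h has_real_derivative std_normal_density t + std_normal_density (- t) * - 1) (at t)" for t
    by (intro DERIV_add DERIV_minus DERIV_ident Phi_has_derivative Phi_has_derivative')
  then have "(?h has_real_derivative 0) (at t)" for t
    by (simp only: std_normal_density_uminus) simp
  then have "\<forall>t. (?h has_real_derivative 0) (at t)" by blast
  then have "?h t = ?h x" for t
    by (rule DERIV_isconst_all)
  then have const: "?h = (\<lambda>_. ?h x)" by (rule ext)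
  have "((\<lambda>t. Phi (- t)) \<longlongrightarrow> 0) at_top"
    by (rule filterlim_compose[OF std_normal.cdf_lim_at_bot filterlim_uminus_at_bot_at_top])
  with std_normal.cdf_lim_at_top_prob have "(?h \<longlongrightarrow> 1 + 0) at_top"
    by (rule tendsto_add)
  then have "((\<lambda>_::real. ?h x) \<longlongrightarrow> 1 + 0) at_top"
    by (subst (asm) const)
  then have "?h x = 1 + 0"
    by (intro tendsto_unique[OF _ tendsto_const]) auto
  then show ?thesis by simp
qed

lemma Phi_0: "Phi 0 = 1 / 2"
  using Phi_uminus[of 0] by simp

text \<open>When a window of half-width \<open>d\<close> and centre \<open>c \<ge> 0\<close> moves
  to the right, it gains density at the far end and loses at the near end, where the density is at
  least as large. So its probability decreases in \<open>c\<close>. A window with negative centre is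
  reflected first.\<close>

lemma Phi_interval_le_centred:
  assumes "a \<le> b"
  shows "Phi b - Phi a \<le> 2 * Phi ((b - a) / 2) - 1"
proof -
  have *: "Phi (c + d) - Phi (c - d) \<le> 2 * Phi d - 1" if "0 \<le> c" "0 \<le> d" for c d
  proof -
    let ?h = "\<lambda>c. Phi (c + d) - Phi (c - d)"
    have "?h c \<le> ?h 0"
    proof (rule DERIV_nonpos_imp_nonincreasing[of 0 c])
      fix t assume "0 \<le> t" "t \<le> c"
      then have "(t - d)\<^sup>2 \<le> (t + d)\<^sup>2"
        using that by (simp add: power2_eq_square algebra_simps)
      then have "std_normal_density (t + d) \<le> std_normal_density (t - d)"
        by (simp add: std_normal_density_def divide_right_mono)
      moreover have "(?h has_real_derivative
          std_normal_density (t + d) * (1 + 0) - std_normal_density (t - d) * (1 - 0)) (at t)"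
        by (intro DERIV_diff DERIV_add DERIV_ident DERIV_const Phi_has_derivative')
      ultimately show "\<exists>D. (?h has_real_derivative D) (at t) \<and> D \<le> 0"
        by (intro exI conjI) auto
    qed fact
    then show ?thesis by (simp add: Phi_uminus)
  qed
  let ?c = "(a + b) / 2" and ?d = "(b - a) / 2"
  show ?thesis
  proof (cases "0 \<le> ?c")
    case True
    have "?c + ?d = b" "?c - ?d = a" by (simp_all add: field_simps)
    then show ?thesis using *[OF True, of ?d] assms by simp
  next
    case False
    have "- ?c + ?d = - a" "- ?c - ?d = - b" by (simp_all add: field_simps)
    moreover have "0 \<le> - ?c" "0 \<le> ?d" using False assms by auto
    note *[OF this]
    ultimately show ?thesis
      by (simp add: Phi_uminus)
  qed
qed

section \<open>The Mills ratio and the Stein solution of a half-line built from it\<close>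

definition mills :: "real \<Rightarrow> real" where
  "mills x = (1 - Phi x) / std_normal_density x"

lemma std_normal_density_pos': "0 < std_normal_density x"
  by (simp add: normal_density_pos)

lemma Phi_le_1: "Phi x \<le> 1"
  by (rule std_normal.cdf_bounded_prob)

lemma Phi_ge_0: "0 \<le> Phi x"
  by (rule std_normal.cdf_nonneg)

lemma Phi_mono: "x \<le> y \<Longrightarrow> Phi x \<le> Phi y"
  by (rule std_normal.cdf_nondecreasing)

lemma mills_nonneg: "0 \<le> mills x"
  by (simp add: mills_def Phi_le_1)

lemma mills_has_derivative: "(mills has_real_derivative x * mills x - 1) (at x)"
proof -
  let ?p = "std_normal_density x"
  have p: "?p \<noteq> 0" using std_normal_density_pos'[of x] by simp
  have "((\<lambda>x. (1 - Phi x) / std_normal_density x) has_real_derivative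
      ((0 - ?p) * ?p - (1 - Phi x) * (- x * ?p)) / (?p * ?p)) (at x)"
    by (intro DERIV_divide DERIV_diff DERIV_const Phi_has_derivative
        std_normal_density_has_derivative p)
  also have "((0 - ?p) * ?p - (1 - Phi x) * (- x * ?p)) / (?p * ?p) = x * mills x - 1"
    using p by (simp add: mills_def field_simps)
  finally show ?thesis by (simp add: mills_def[abs_def])
qed

lemmas mills_has_derivative' = DERIV_chain2[OF mills_has_derivative]

text \<open>The difference \<open>?h\<close> of the two sides of the Gaussian tail bound has
  derivative \<open>- std_normal_density t / t\<^sup>2\<close>, hence decreases strictly, and it
  tends to 0 at infinity; so it is positive.\<close>

lemma mills_ratio_le:
  assumes "0 < x"
  shows "x * mills x \<le> 1"
proof -
  let ?h = "\<lambda>t. std_normal_density t / t - (1 - Phi t)"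
  have "0 < ?h x"
  proof (rule DERIV_neg_imp_decreasing_at_top[where b = x and flim = 0])
    fix t assume "x \<le> t"
    with assms have t: "0 < t" by simp
    let ?p = "std_normal_density t"
    have "(?h has_real_derivative (- t * ?p * t - ?p * 1) / (t * t) - (0 - ?p)) (at t)"
      using t by (intro DERIV_divide DERIV_diff DERIV_const Phi_has_derivative DERIV_ident
          std_normal_density_has_derivative) simp
    also have "(- t * ?p * t - ?p * 1) / (t * t) - (0 - ?p) = - ?p / t\<^sup>2"
      using t by (simp add: field_simps power2_eq_square)
    finally have "(?h has_real_derivative - ?p / t\<^sup>2) (at t)" .
    moreover have "- std_normal_density t / t\<^sup>2 < 0"
      using t std_normal_density_pos'[of t] by simp
    ultimately show "\<exists>y. (?h has_real_derivative y) (at t) \<and> y < 0" by blast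
  next
    have "((\<lambda>t. std_normal_density t / t) \<longlongrightarrow> 0) at_top"
    proof (rule tendsto_sandwich)
      show "\<forall>\<^sub>F t in at_top. 0 \<le> std_normal_density t / t"
        using eventually_gt_at_top[of 0] by eventually_elim simp
      show "\<forall>\<^sub>F t in at_top. std_normal_density t / t \<le> (1 / 2) / t"
        using eventually_gt_at_top[of 0]
        by eventually_elim (intro divide_right_mono std_normal_density_le_half, simp)
      show "((\<lambda>t::real. (1 / 2) / t) \<longlongrightarrow> 0) at_top"
        by (rule real_tendsto_divide_at_top[OF tendsto_const filterlim_ident])
    qed simp
    moreover have "((\<lambda>t. 1 - Phi t) \<longlongrightarrow> 1 - 1) at_top"
      by (intro tendsto_intros std_normal.cdf_lim_at_top_prob)
    ultimately have "(?h \<longlongrightarrow> 0 - (1 - 1)) at_top"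
      by (rule tendsto_diff)
    then show "(?h \<longlongrightarrow> 0) at_top" by simp
  qed
  then have "1 - Phi x \<le> std_normal_density x / x" by simp
  then have "x * (1 - Phi x) \<le> std_normal_density x"
    using assms by (simp add: le_divide_eq mult.commute)
  then show ?thesis
    using std_normal_density_pos'[of x] by (simp add: mills_def divide_le_eq)
qed

text \<open>A crude bound suffices; the value at 0 is sqrt(pi/2). Up to 1/2 the quotient is at most
  (1/2) / (1/4), and beyond 1/2 the tail bound gives 1/x < 2.\<close>

lemma mills_le_2:
  assumes "0 \<le> x"
  shows "mills x \<le> 2"
proof (cases "x \<le> 1 / 2")
  case True
  then have "1 / 4 \<le> std_normal_density x"
    using assms by (intro std_normal_density_ge_quarter) auto
  moreover have "1 - Phi x \<le> 1 / 2"
    using Phi_mono[OF assms] by (simp add: Phi_0)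
  ultimately show ?thesis
    using std_normal_density_pos'[of x] by (simp add: mills_def divide_le_eq)
next
  case False
  have "1 / 2 * mills x \<le> x * mills x"
    using False by (intro mult_right_mono mills_nonneg) auto
  also have "\<dots> \<le> 1"
    using False by (intro mills_ratio_le) auto
  finally show ?thesis by simp
qed

lemma mills_reflect: "mills (- x) * (1 - Phi x) = mills x * Phi x"
  by (simp add: mills_def Phi_uminus std_normal_density_uminus)

text \<open>For positive \<open>w\<close> the factor \<open>mills (- w)\<close> is unbounded, but
  \<open>1 - Phi z \<le> 1 - Phi w\<close> compensates: \<open>mills_reflect\<close> turns the
  resulting product into \<open>mills w * Phi w\<close>, where the bounds for a positive argument
  apply. Treating the branch left of \<open>z\<close> is enough, since (w, z) -> (-w, -z) maps the
  other branch to it.\<close>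

lemma stein_branch_bounds:
  assumes "w \<le> z"
  shows "mills (- w) * (1 - Phi z) \<le> 2"
    and "0 \<le> (1 - Phi z) * (1 + w * mills (- w))"
    and "(1 - Phi z) * (1 + w * mills (- w)) \<le> 1"
proof -
  have z: "0 \<le> 1 - Phi z" "1 - Phi z \<le> 1" "1 - Phi z \<le> 1 - Phi w"
    using Phi_le_1 Phi_ge_0 Phi_mono[OF assms] by auto
  have "mills (- w) * (1 - Phi z) \<le> 2 \<and> 0 \<le> (1 - Phi z) * (1 + w * mills (- w)) \<and>
    (1 - Phi z) * (1 + w * mills (- w)) \<le> 1"
  proof (cases "w \<le> 0")
    case True
    have "mills (- w) * (1 - Phi z) \<le> 2 * 1"
      using True z by (intro mult_mono mills_le_2) auto
    moreover have "- 1 \<le> w * mills (- w)"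
      using mills_ratio_le[of "- w"] True by (cases "w = 0") auto
    moreover have "w * mills (- w) \<le> 0"
      using True mills_nonneg[of "- w"] by (simp add: mult_nonpos_nonneg)
    ultimately show ?thesis
      using z mult_mono[of "1 - Phi z" 1 "1 + w * mills (- w)" 1] by auto
  next
    case False
    have "mills (- w) * (1 - Phi z) \<le> mills (- w) * (1 - Phi w)"
      using z by (intro mult_left_mono mills_nonneg)
    also have "\<dots> = mills w * Phi w" by (rule mills_reflect)
    finally have le: "mills (- w) * (1 - Phi z) \<le> mills w * Phi w" .
    have "mills w * Phi w \<le> 2 * 1"
      using False by (intro mult_mono mills_le_2 Phi_le_1 Phi_ge_0) auto
    moreover have "w * (mills (- w) * (1 - Phi z)) \<le> w * (mills w * Phi w)"
      using False le by (intro mult_left_mono) auto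
    moreover have "(w * mills w) * Phi w \<le> 1 * Phi w"
      using False by (intro mult_right_mono mills_ratio_le Phi_ge_0) auto
    moreover have "0 \<le> w * mills (- w)"
      using False mills_nonneg[of "- w"] by simp
    then have "0 \<le> (1 - Phi z) * (1 + w * mills (- w))"
      using z by simp
    moreover have "(1 - Phi z) * (1 + w * mills (- w)) = 1 - Phi z + w * (mills (- w) * (1 - Phi z))"
      by (simp add: algebra_simps)
    ultimately show ?thesis
      using le z by auto
  qed
  then show "mills (- w) * (1 - Phi z) \<le> 2"
    "0 \<le> (1 - Phi z) * (1 + w * mills (- w))"
    "(1 - Phi z) * (1 + w * mills (- w)) \<le> 1" by auto
qed

text \<open>The bounded solution of f'(w) - w f(w) = 1{w \<le> z} - Phi(z). Since
  \<open>mills (- w)\<close> equals \<open>Phi w / std_normal_density w\<close>, this is the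
  classical formula with the factor exp(w^2/2) absorbed into the Mills ratio.\<close>

definition stein_sol :: "real \<Rightarrow> real \<Rightarrow> real" where
  "stein_sol z w = (if w \<le> z then mills (- w) * (1 - Phi z) else mills w * Phi z)"

text \<open>Read off from Stein's equation instead of being defined as a derivative, so that the
  equation holds at every point, including the kink \<open>z\<close>, where \<open>W\<close> may
  have an atom.\<close>

definition stein_deriv :: "real \<Rightarrow> real \<Rightarrow> real" where
  "stein_deriv z w = w * stein_sol z w + indicator {..z} w - Phi z"

lemma stein_sol_nonneg: "0 \<le> stein_sol z w"
  by (simp add: stein_sol_def mills_nonneg Phi_le_1 Phi_ge_0)

lemma stein_sol_le_2: "stein_sol z w \<le> 2"
proof (cases "w \<le> z")
  case True
  then show ?thesis using stein_branch_bounds(1) by (simp add: stein_sol_def)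
next
  case False
  then show ?thesis
    using stein_branch_bounds(1)[of "- w" "- z"] by (simp add: stein_sol_def Phi_uminus)
qed

lemma abs_stein_deriv_le_1: "\<bar>stein_deriv z w\<bar> \<le> 1"
proof (cases "w \<le> z")
  case True
  then have "stein_deriv z w = (1 - Phi z) * (1 + w * mills (- w))"
    by (simp add: stein_deriv_def stein_sol_def algebra_simps)
  then show ?thesis using stein_branch_bounds(2,3)[OF True] by simp
next
  case False
  then have "stein_deriv z w = - ((1 - Phi (- z)) * (1 + (- w) * mills (- (- w))))"
    by (simp add: stein_deriv_def stein_sol_def Phi_uminus algebra_simps)
  then show ?thesis using stein_branch_bounds(2,3)[of "- w" "- z"] False by simp
qed

lemma continuous_mills: "continuous_on A mills"
  using mills_has_derivative by (meson DERIV_isCont continuous_at_imp_continuous_on)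

lemma continuous_stein_sol: "continuous_on UNIV (stein_sol z)"
proof -
  have "continuous_on ({..z} \<union> {z..})
    (\<lambda>w. if w \<le> z then mills (- w) * (1 - Phi z) else mills w * Phi z)"
    by (intro continuous_on_If continuous_intros
        continuous_on_compose2[OF continuous_mills[of UNIV]])
      (auto simp: mills_reflect)
  moreover have "{..z} \<union> {z..} = UNIV" by auto
  ultimately show ?thesis by (simp add: stein_sol_def[abs_def])
qed

lemma borel_measurable_stein_sol [measurable]: "stein_sol z \<in> borel_measurable borel"
  by (rule borel_measurable_continuous_onI[OF continuous_stein_sol])

lemma borel_measurable_stein_deriv [measurable]: "stein_deriv z \<in> borel_measurable borel"
  unfolding stein_deriv_def by measurable

lemma stein_sol_has_derivative:
  assumes "w \<noteq> z"
  shows "(stein_sol z has_real_derivative stein_deriv z w) (at w)"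
proof (cases "w < z")
  case True
  have "((\<lambda>w. mills (- w) * (1 - Phi z)) has_real_derivative
      ((- w * mills (- w) - 1) * - 1) * (1 - Phi z)) (at w)"
    by (intro DERIV_cmult_right mills_has_derivative' DERIV_minus DERIV_ident)
  also have "((- w * mills (- w) - 1) * - 1) * (1 - Phi z) = stein_deriv z w"
    using True by (simp add: stein_deriv_def stein_sol_def algebra_simps)
  finally have "((\<lambda>w. mills (- w) * (1 - Phi z)) has_real_derivative stein_deriv z w) (at w)" .
  moreover have "\<forall>\<^sub>F t in nhds w. t \<in> {..<z}"
    using True by (intro eventually_nhds_in_open) auto
  then have "\<forall>\<^sub>F t in nhds w. stein_sol z t = mills (- t) * (1 - Phi z)"
    by eventually_elim (simp add: stein_sol_def)
  ultimately show ?thesis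
    by (rule DERIV_transform_eventually)
next
  case False
  with assms have w: "z < w" by simp
  have "((\<lambda>w. mills w * Phi z) has_real_derivative (w * mills w - 1) * Phi z) (at w)"
    by (intro DERIV_cmult_right mills_has_derivative)
  also have "(w * mills w - 1) * Phi z = stein_deriv z w"
    using w by (simp add: stein_deriv_def stein_sol_def algebra_simps)
  finally have "((\<lambda>w. mills w * Phi z) has_real_derivative stein_deriv z w) (at w)" .
  moreover have "\<forall>\<^sub>F t in nhds w. t \<in> {z<..}"
    using w by (intro eventually_nhds_in_open) auto
  then have "\<forall>\<^sub>F t in nhds w. stein_sol z t = mills t * Phi z"
    by eventually_elim (simp add: stein_sol_def)
  ultimately show ?thesis
    by (rule DERIV_transform_eventually)
qed

lemma stein_deriv_has_integral:
  assumes "a \<le> b"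
  shows "(stein_deriv z has_integral stein_sol z b - stein_sol z a) {a..b}"
proof (rule fundamental_theorem_of_calculus_strong[where S = "{z}"])
  fix w assume "w \<in> {a..b} - {z}"
  then show "(stein_sol z has_vector_derivative stein_deriv z w) (at w)"
    using stein_sol_has_derivative[of w z]
    by (simp add: has_real_derivative_iff_has_vector_derivative)
next
  show "continuous_on {a..b} (stein_sol z)"
    by (rule continuous_on_subset[OF continuous_stein_sol]) simp
qed (use assms in auto)

lemma stein_sol_lipschitz: "\<bar>stein_sol z u - stein_sol z v\<bar> \<le> \<bar>u - v\<bar>"
proof -
  have *: "\<bar>stein_sol z b - stein_sol z a\<bar> \<le> b - a" if "a \<le> b" for a b
    using has_integral_bound_real[OF _ _ stein_deriv_has_integral[OF that], of 1 "{}"]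
      abs_stein_deriv_le_1 that by simp
  show ?thesis using *[of u v] *[of v u] by (cases "u \<le> v") (auto simp: abs_minus_commute)
qed

text \<open>Stein's equation splits the difference into increments of w f(w), which are of order |u
  - w|, and the increment of the indicator, which is not; the latter is kept as the event that
  \<open>z\<close> separates \<open>u\<close> and \<open>w\<close>.\<close>

lemma stein_deriv_diff_le:
  "\<bar>stein_deriv z u - stein_deriv z w\<bar>
    \<le> (\<bar>w\<bar> + 2) * \<bar>u - w\<bar> + indicator {min w u..max w u} z"
proof -
  have "stein_deriv z u - stein_deriv z w
      = w * (stein_sol z u - stein_sol z w) + (u - w) * stein_sol z u
        + (indicator {..z} u - indicator {..z} w)"
    by (simp add: stein_deriv_def algebra_simps)
  moreover have "\<bar>w * (stein_sol z u - stein_sol z w)\<bar> \<le> \<bar>w\<bar> * \<bar>u - w\<bar>"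
    unfolding abs_mult by (intro mult_left_mono stein_sol_lipschitz) auto
  moreover have "\<bar>(u - w) * stein_sol z u\<bar> \<le> \<bar>u - w\<bar> * 2"
    unfolding abs_mult using stein_sol_nonneg[of z u] stein_sol_le_2[of z u]
    by (intro mult_left_mono) auto
  moreover have "\<bar>indicator {..z} u - indicator {..z} w :: real\<bar> \<le> indicator {min w u..max w u} z"
    by (auto simp: indicator_def)
  ultimately show ?thesis
    unfolding distrib_right by linarith
qed

text \<open>Integrates \<open>stein_deriv_diff_le\<close> along the segment from \<open>w\<close> to
  \<open>w + y\<close>, charging the jump on the whole segment whenever \<open>z\<close> lies on it.
  That event is written as a condition on \<open>w\<close>, so that its expectation under
  \<open>W\<close> is an interval probability.\<close>

lemma stein_sol_taylor:
  "\<bar>y * stein_deriv z w - (stein_sol z (w + y) - stein_sol z w)\<bar>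
    \<le> (\<bar>w\<bar> + 2) * y\<^sup>2 / 2 + \<bar>y\<bar> * indicator {min z (z - y)..max z (z - y)} w"
proof -
  define J :: real where "J = indicator {min z (z - y)..max z (z - y)} w"
  have pt: "norm (stein_deriv z u - stein_deriv z w) \<le> (\<bar>w\<bar> + 2) * \<bar>u - w\<bar> + J"
    if "u \<in> {min w (w + y)..max w (w + y)}" for u
  proof -
    have "indicator {min w u..max w u} z \<le> J"
      using that by (auto simp: J_def indicator_def min_def max_def split: if_splits)
    then show ?thesis using stein_deriv_diff_le[of z u w] by simp
  qed
  show ?thesis
  proof (cases "0 \<le> y")
    case True
    have L: "((\<lambda>u. stein_deriv z u - stein_deriv z w) has_integral
        (stein_sol z (w + y) - stein_sol z w) - y * stein_deriv z w) {w..w + y}"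
      using has_integral_diff[OF stein_deriv_has_integral[of w "w + y" z]
          has_integral_const_real[of "stein_deriv z w" w "w + y"]] True by simp
    have "((\<lambda>u. (\<bar>w\<bar> + 2) * \<bar>u - w\<bar> + J) has_integral
        ((\<bar>w\<bar> + 2) * (w + y - w)\<^sup>2 / 2 + J * (w + y)) - ((\<bar>w\<bar> + 2) * (w - w)\<^sup>2 / 2 + J * w))
        {w..w + y}"
    proof (rule fundamental_theorem_of_calculus)
      fix u assume "u \<in> {w..w + y}"
      then have "(\<bar>w\<bar> + 2) * \<bar>u - w\<bar> + J = (\<bar>w\<bar> + 2) * (2 * (u - w)) / 2 + J" by simp
      then show "((\<lambda>u. (\<bar>w\<bar> + 2) * (u - w)\<^sup>2 / 2 + J * u) has_vector_derivative
          (\<bar>w\<bar> + 2) * \<bar>u - w\<bar> + J) (at u within {w..w + y})"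
        unfolding has_real_derivative_iff_has_vector_derivative[symmetric]
        by (auto intro!: derivative_eq_intros)
    qed (use True in simp)
    then have R: "((\<lambda>u. (\<bar>w\<bar> + 2) * \<bar>u - w\<bar> + J) has_integral
        (\<bar>w\<bar> + 2) * y\<^sup>2 / 2 + \<bar>y\<bar> * J) {w..w + y}"
      using True by (simp add: algebra_simps)
    have "norm (integral {w..w + y} (\<lambda>u. stein_deriv z u - stein_deriv z w))
        \<le> integral {w..w + y} (\<lambda>u. (\<bar>w\<bar> + 2) * \<bar>u - w\<bar> + J)"
      using True pt by (intro integral_norm_bound_integral has_integral_integrable[OF L]
          has_integral_integrable[OF R]) auto
    then show ?thesis
      using integral_unique[OF L] integral_unique[OF R] by (simp add: J_def abs_minus_commute)
  next
    case False
    have L: "((\<lambda>u. stein_deriv z u - stein_deriv z w) has_integral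
        (stein_sol z w - stein_sol z (w + y)) + y * stein_deriv z w) {w + y..w}"
      using has_integral_diff[OF stein_deriv_has_integral[of "w + y" w z]
          has_integral_const_real[of "stein_deriv z w" "w + y" w]] False by simp
    have "((\<lambda>u. (\<bar>w\<bar> + 2) * \<bar>u - w\<bar> + J) has_integral
        (- (\<bar>w\<bar> + 2) * (w - w)\<^sup>2 / 2 + J * w) - (- (\<bar>w\<bar> + 2) * (w + y - w)\<^sup>2 / 2 + J * (w + y)))
        {w + y..w}"
    proof (rule fundamental_theorem_of_calculus)
      fix u assume "u \<in> {w + y..w}"
      then have "(\<bar>w\<bar> + 2) * \<bar>u - w\<bar> + J = - (\<bar>w\<bar> + 2) * (2 * (u - w)) / 2 + J"
        by (simp add: abs_of_nonpos) (simp add: algebra_simps)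
      then show "((\<lambda>u. - (\<bar>w\<bar> + 2) * (u - w)\<^sup>2 / 2 + J * u) has_vector_derivative
          (\<bar>w\<bar> + 2) * \<bar>u - w\<bar> + J) (at u within {w + y..w})"
        unfolding has_real_derivative_iff_has_vector_derivative[symmetric]
        by (auto intro!: derivative_eq_intros)
    qed (use False in simp)
    then have R: "((\<lambda>u. (\<bar>w\<bar> + 2) * \<bar>u - w\<bar> + J) has_integral
        (\<bar>w\<bar> + 2) * y\<^sup>2 / 2 + \<bar>y\<bar> * J) {w + y..w}"
      by (rule has_integral_eq_rhs) (use False in \<open>simp add: field_simps power2_eq_square\<close>)
    have "norm (integral {w + y..w} (\<lambda>u. stein_deriv z u - stein_deriv z w))
        \<le> integral {w + y..w} (\<lambda>u. (\<bar>w\<bar> + 2) * \<bar>u - w\<bar> + J)"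
      using False pt by (intro integral_norm_bound_integral has_integral_integrable[OF L]
          has_integral_integrable[OF R]) auto
    then show ?thesis
      using integral_unique[OF L] integral_unique[OF R] by (simp add: J_def algebra_simps)
  qed
qed

subsection \<open>Normal approximation from the Palm identity\<close>

lemma integrable_mult_bounded:
  fixes u v :: "'a \<Rightarrow> real"
  assumes u: "integrable N u" and [measurable]: "v \<in> borel_measurable N" and B: "\<And>x. \<bar>v x\<bar> \<le> B"
  shows "integrable N (\<lambda>x. u x * v x)"
proof (rule Bochner_Integration.integrable_bound)
  show "integrable N (\<lambda>x. B * u x)"
    using u by (rule integrable_mult_right)
  have "\<bar>v x\<bar> \<le> \<bar>B\<bar>" for x using B[of x] by simp
  then have "norm (u x * v x) \<le> norm (B * u x)" for x
    by (simp add: abs_mult mult.commute[of "\<bar>u x\<bar>"] mult_right_mono)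
  then show "AE x in N. norm (u x * v x) \<le> norm (B * u x)" by simp
qed (use u in measurable)

lemma (in prob_space) abs_expectation_le:
  assumes "\<And>\<omega>. \<bar>g \<omega>\<bar> \<le> (B::real)"
  shows "\<bar>\<integral>\<omega>. g \<omega> \<partial>M\<bar> \<le> B"
proof (cases "integrable M g")
  case True
  have "\<bar>\<integral>\<omega>. g \<omega> \<partial>M\<bar> \<le> (\<integral>\<omega>. \<bar>g \<omega>\<bar> \<partial>M)" by (rule integral_abs_bound)
  also have "\<dots> \<le> (\<integral>\<omega>. B \<partial>M)"
    using True assms by (intro integral_mono) auto
  finally show ?thesis by (simp add: prob_space)
next
  \<comment> \<open>The integral has its default value 0, and \<open>B\<close> is nonnegative
    because it bounds an absolute value.\<close>
  case False
  then show ?thesis using assms[of undefined] by (simp add: not_integrable_integral_eq)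
qed

text \<open>
  \<open>W\<close> stands for the law of a compound Poisson variable with jump law \<open>Y\<close>; everything
  needed about it is contained in the Palm identity.
\<close>

locale centred_palm = W: prob_space W + Y: prob_space Y
  for W Y :: "real measure" +
  fixes rate :: real
  assumes sets_W [measurable_cong, simp]: "sets W = sets borel"
    and sets_Y [measurable_cong, simp]: "sets Y = sets borel"
    and rate_nonneg: "0 \<le> rate"
    and integrable_W: "integrable W (\<lambda>w. w)"
    and integrable_Y_sq: "integrable Y (\<lambda>y. y\<^sup>2)"
    and mean_Y: "(\<integral>y. y \<partial>Y) = 0"
    and variance_Y: "rate * (\<integral>y. y\<^sup>2 \<partial>Y) = 1"
    and palm: "\<And>f B. f \<in> borel_measurable borel \<Longrightarrow> (\<And>w. \<bar>f w\<bar> \<le> (B::real)) \<Longrightarrow>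
      (\<integral>w. w * f w \<partial>W) = rate * (\<integral>y. y * (\<integral>w. f (w + y) \<partial>W) \<partial>Y)"
begin

lemma space_W [simp]: "space W = UNIV"
  using sets_eq_imp_space_eq[OF sets_W] by simp

lemma measure_W_UNIV [simp]: "measure W UNIV = 1"
  using W.prob_space by simp

lemma integrable_Y: "integrable Y (\<lambda>y. y)"
proof (rule Bochner_Integration.integrable_bound)
  show "integrable Y (\<lambda>y. 1 + y\<^sup>2)"
    by (intro Bochner_Integration.integrable_add integrable_Y_sq) simp
  have "\<bar>y\<bar> \<le> 1 + y\<^sup>2" for y :: real
    using zero_le_power2[of "\<bar>y\<bar> - 1"] by (simp add: power2_eq_square algebra_simps)
  then show "AE y in Y. norm y \<le> norm (1 + y\<^sup>2)" by auto
qed simp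

lemma integrable_W_bounded:
  fixes f :: "real \<Rightarrow> real"
  assumes [measurable]: "f \<in> borel_measurable borel" and "\<And>w. \<bar>f w\<bar> \<le> B"
  shows "integrable W f"
  using assms by (intro W.integrable_const_bound[where B = B]) auto

lemma integrable_W_mult:
  fixes f :: "real \<Rightarrow> real"
  assumes "f \<in> borel_measurable borel" and "\<And>w. \<bar>f w\<bar> \<le> B"
  shows "integrable W (\<lambda>w. w * f w)"
  using assms by (intro integrable_mult_bounded[OF integrable_W]) simp_all

lemma integrable_shift:
  fixes f :: "real \<Rightarrow> real"
  assumes [measurable]: "f \<in> borel_measurable borel" and "\<And>w. \<bar>f w\<bar> \<le> B"
  shows "integrable W (\<lambda>w. f (w + y))"
  using assms by (intro integrable_W_bounded) auto

lemma integrable_palm: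
  fixes f :: "real \<Rightarrow> real"
  assumes [measurable]: "f \<in> borel_measurable borel" and B: "\<And>w. \<bar>f w\<bar> \<le> B"
  shows "integrable Y (\<lambda>y. y * (\<integral>w. f (w + y) \<partial>W))"
proof (rule integrable_mult_bounded[OF integrable_Y])
  show "\<bar>\<integral>w. f (w + y) \<partial>W\<bar> \<le> B" for y
    by (rule W.abs_expectation_le) (rule B)
qed measurable

text \<open>Centred jumps allow \<open>f w\<close> to be subtracted. For Lipschitz \<open>f\<close>
  the integrand is then of order y^2, which is all that a finite second moment of the jumps can
  support.\<close>

lemma palm_diff:
  fixes f :: "real \<Rightarrow> real"
  assumes [measurable]: "f \<in> borel_measurable borel" and B: "\<And>w. \<bar>f w\<bar> \<le> B"
  shows "(\<integral>w. w * f w \<partial>W) = rate * (\<integral>y. y * (\<integral>w. f (w + y) - f w \<partial>W) \<partial>Y)"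
    and "integrable Y (\<lambda>y. y * (\<integral>w. f (w + y) - f w \<partial>W))"
proof -
  have eq: "y * (\<integral>w. f (w + y) - f w \<partial>W) = y * (\<integral>w. f (w + y) \<partial>W) - y * (\<integral>w. f w \<partial>W)" for y
    by (subst Bochner_Integration.integral_diff[OF integrable_shift[OF assms]
          integrable_W_bounded[OF assms]]) (rule right_diff_distrib)
  show "integrable Y (\<lambda>y. y * (\<integral>w. f (w + y) - f w \<partial>W))"
    unfolding eq by (intro Bochner_Integration.integrable_diff integrable_palm[OF assms]
        integrable_mult_left integrable_Y)
  show "(\<integral>w. w * f w \<partial>W) = rate * (\<integral>y. y * (\<integral>w. f (w + y) - f w \<partial>W) \<partial>Y)"
    unfolding eq
    by (subst Bochner_Integration.integral_diff)
      (use integrable_palm[OF assms] integrable_Y palm[OF assms] mean_Y in auto)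
qed

text \<open>The identity function would give the second moment of \<open>W\<close>, but
  \<open>palm\<close> asks for a bounded function. Its clamp is still 1-Lipschitz, so
  \<open>w * f w\<close> has expectation at most
  \<open>rate * (\<integral>y. y\<^sup>2 \<partial>Y) = 1\<close>.\<close>

lemma abs_moment_W: "(\<integral>w. \<bar>w\<bar> \<partial>W) \<le> 1"
proof -
  \<comment> \<open>The truncation level is chosen such that \<open>2 \<bar>w\<bar> \<le> 1 + w * f w\<close>.\<close>
  define f :: "real \<Rightarrow> real" where "f w = max (- 2) (min 2 w)" for w
  have [measurable]: "f \<in> borel_measurable borel" unfolding f_def by measurable
  have B: "\<bar>f w\<bar> \<le> 2" for w by (auto simp: f_def)
  have lip: "\<bar>f (w + y) - f w\<bar> \<le> \<bar>y\<bar>" for w y by (auto simp: f_def)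
  have le: "y * (\<integral>w. f (w + y) - f w \<partial>W) \<le> y\<^sup>2" for y
  proof -
    have "y * (\<integral>w. f (w + y) - f w \<partial>W) = (\<integral>w. y * (f (w + y) - f w) \<partial>W)"
      by simp
    also have "\<dots> \<le> (\<integral>w. y\<^sup>2 \<partial>W)"
    proof (rule integral_mono)
      show "integrable W (\<lambda>w. y * (f (w + y) - f w))"
        by (intro integrable_mult_right Bochner_Integration.integrable_diff
            integrable_shift[OF _ B] integrable_W_bounded[OF _ B]) auto
      fix w
      have "y * (f (w + y) - f w) \<le> \<bar>y\<bar> * \<bar>f (w + y) - f w\<bar>"
        by (metis abs_ge_self abs_mult)
      also have "\<dots> \<le> \<bar>y\<bar> * \<bar>y\<bar>" by (intro mult_left_mono lip) simp
      finally show "y * (f (w + y) - f w) \<le> y\<^sup>2" by (simp add: power2_eq_square)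
    qed simp
    finally show ?thesis by (simp add: W.prob_space)
  qed
  have "(\<integral>w. w * f w \<partial>W) = rate * (\<integral>y. y * (\<integral>w. f (w + y) - f w \<partial>W) \<partial>Y)"
    by (rule palm_diff[OF _ B]) simp
  also have "\<dots> \<le> rate * (\<integral>y. y\<^sup>2 \<partial>Y)"
    by (intro mult_left_mono integral_mono palm_diff(2)[OF _ B] integrable_Y_sq le rate_nonneg) simp
  finally have "(\<integral>w. w * f w \<partial>W) \<le> 1" by (simp add: variance_Y)
  moreover have "(\<integral>w. 2 * \<bar>w\<bar> \<partial>W) \<le> (\<integral>w. 1 + w * f w \<partial>W)"
  proof (rule integral_mono)
    show "integrable W (\<lambda>w. 2 * \<bar>w\<bar>)"
      by (intro integrable_mult_right integrable_abs integrable_W)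
    show "integrable W (\<lambda>w. 1 + w * f w)"
      by (intro Bochner_Integration.integrable_add integrable_W_mult[OF _ B]) auto
    fix w :: real
    show "2 * \<bar>w\<bar> \<le> 1 + w * f w"
      using zero_le_power2[of "\<bar>w\<bar> - 1"]
      by (auto simp: f_def power2_eq_square algebra_simps max_def min_def)
  qed
  ultimately show ?thesis
    using integrable_W_mult[OF _ B] by (simp add: W.prob_space)
qed

text \<open>A Lindeberg-type quantity: the third absolute moment of the jumps up to size 1 plus the
  second moment beyond, hence finite under a second-moment assumption.\<close>

definition trunc_moment :: real where
  "trunc_moment = rate * (\<integral>y. min (y\<^sup>2) (\<bar>y\<bar> ^ 3) \<partial>Y)"

lemma integrable_trunc: "integrable Y (\<lambda>y. min (y\<^sup>2) (\<bar>y\<bar> ^ 3))"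
  by (rule Bochner_Integration.integrable_bound[OF integrable_Y_sq]) auto

text \<open>For d < |y| \<le> 1 the gap between the two sides is |y| (|y| - 2d)^2 / (4d); the factor
  4d is the one for which a perfect square appears. For |y| > 1 the minimum is y^2, and
  \<open>d \<le> 1 / 4\<close> makes the left side nonpositive.\<close>

lemma quadratic_truncation:
  fixes y d :: real
  assumes "0 < d" "d \<le> 1 / 4"
  shows "y\<^sup>2 - min (y\<^sup>2) (\<bar>y\<bar> ^ 3) / (4 * d) \<le> \<bar>y\<bar> * min \<bar>y\<bar> d"
proof -
  define t where "t = \<bar>y\<bar>"
  have t: "0 \<le> t" "y\<^sup>2 = t\<^sup>2" by (simp_all add: t_def)
  have "t\<^sup>2 - min (t\<^sup>2) (t ^ 3) / (4 * d) \<le> t * min t d"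
  proof (cases "t \<le> d")
    case True
    then show ?thesis using t assms by (simp add: power2_eq_square)
  next
    case ne: False
    show ?thesis
    proof (cases "t \<le> 1")
      case True
      have "t ^ 3 \<le> t\<^sup>2" using t True by (intro power_decreasing) auto
      moreover have "t * d - (t\<^sup>2 - t ^ 3 / (4 * d)) = t * (t - 2 * d)\<^sup>2 / (4 * d)"
        using assms by (simp add: field_simps power2_eq_square power3_eq_cube)
      moreover have "0 \<le> t * (t - 2 * d)\<^sup>2 / (4 * d)"
        using t assms by simp
      ultimately show ?thesis using ne by (simp add: min_def)
    next
      case False
      have "t\<^sup>2 \<le> t ^ 3" using False by (intro power_increasing) auto
      moreover have "(4 * d) * t\<^sup>2 \<le> 1 * t\<^sup>2" using assms by (intro mult_right_mono) auto
      then have "t\<^sup>2 \<le> t\<^sup>2 / (4 * d)" using assms by (simp add: le_divide_eq mult.commute)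
      moreover have "0 \<le> t * d" using t assms by simp
      ultimately show ?thesis using ne by (simp add: min_def)
    qed
  qed
  then show ?thesis by (simp add: t_def)
qed

text \<open>The expectation of \<open>w * f w\<close> is estimated twice. From above, |f| \<le> h
  and \<open>abs_moment_W\<close> give \<open>h\<close>. From below, \<open>f\<close> is
  nondecreasing, so start points outside \<open>{a..b}\<close> contribute nothing negative, while
  those inside contribute at least |y| min(|y|, d). By \<open>quadratic_truncation\<close> and
  \<open>small\<close> the total is at least half of \<open>?P\<close>, whence the bound 2h.\<close>

lemma concentration:
  assumes ab: "a \<le> b" and d: "0 < d" "d \<le> 1 / 4" and small: "trunc_moment \<le> 2 * d"
  shows "measure W {a..b} \<le> b - a + 2 * d"
proof -
  define h m where "h = (b - a) / 2 + d" and "m = (a + b) / 2"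
  \<comment> \<open>Of slope 1 on \<open>{a - d..b + d}\<close>, so that jumps of size at most \<open>d\<close> from \<open>{a..b}\<close> are fully seen.\<close>
  define f where "f w = max (- h) (min h (w - m))" for w
  let ?P = "measure W {a..b}"
  have h: "0 < h" unfolding h_def using ab d by (intro add_nonneg_pos) auto
  have [measurable]: "f \<in> borel_measurable borel" unfolding f_def by measurable
  have B: "\<bar>f w\<bar> \<le> h" for w using h by (auto simp: f_def)
  have pt: "\<bar>y\<bar> * min \<bar>y\<bar> d * indicator {a..b} w \<le> y * (f (w + y) - f w)" for w y
  proof (cases "w \<in> {a..b}")
    case True
    then have w: "\<bar>w - m\<bar> \<le> h - d" by (auto simp: h_def m_def field_simps abs_if)
    then have "f w = w - m" using d by (auto simp: f_def)
    show ?thesis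
    proof (cases "0 \<le> y")
      case True
      then have "min \<bar>y\<bar> d \<le> f (w + y) - f w" using w d by (auto simp: f_def)
      then have "\<bar>y\<bar> * min \<bar>y\<bar> d \<le> y * (f (w + y) - f w)"
        using True by (simp add: mult_left_mono)
      then show ?thesis using \<open>w \<in> _\<close> by simp
    next
      case False
      then have "min \<bar>y\<bar> d \<le> - (f (w + y) - f w)" using w d by (auto simp: f_def)
      then have "\<bar>y\<bar> * min \<bar>y\<bar> d \<le> \<bar>y\<bar> * - (f (w + y) - f w)"
        by (intro mult_left_mono) auto
      also have "\<dots> = y * (f (w + y) - f w)" using False by (simp add: algebra_simps)
      finally show ?thesis using \<open>w \<in> _\<close> by simp
    qed
  next
    case False
    have "0 \<le> y * (f (w + y) - f w)"
    proof (cases "0 \<le> y")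
      case True
      then have "0 \<le> f (w + y) - f w" by (auto simp: f_def)
      then show ?thesis using True by simp
    next
      case False
      then have "f (w + y) - f w \<le> 0" by (auto simp: f_def)
      then show ?thesis using False by (simp add: mult_nonpos_nonpos)
    qed
    then show ?thesis using False by simp
  qed
  have lower: "(y\<^sup>2 - min (y\<^sup>2) (\<bar>y\<bar> ^ 3) / (4 * d)) * ?P \<le> y * (\<integral>w. f (w + y) - f w \<partial>W)" for y
  proof -
    have "(y\<^sup>2 - min (y\<^sup>2) (\<bar>y\<bar> ^ 3) / (4 * d)) * ?P \<le> \<bar>y\<bar> * min \<bar>y\<bar> d * ?P"
      by (intro mult_right_mono quadratic_truncation d) auto
    also have "\<dots> = (\<integral>w. \<bar>y\<bar> * min \<bar>y\<bar> d * indicator {a..b} w \<partial>W)"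
      by simp
    also have "\<dots> \<le> (\<integral>w. y * (f (w + y) - f w) \<partial>W)"
      by (intro integral_mono integrable_mult_right Bochner_Integration.integrable_diff
            integrable_shift[OF _ B] integrable_W_bounded[OF _ B] pt)
        (auto intro: integrable_W_bounded[where B = 1] simp: indicator_def)
    finally show ?thesis by simp
  qed
  have "rate * (\<integral>y. (y\<^sup>2 - min (y\<^sup>2) (\<bar>y\<bar> ^ 3) / (4 * d)) * ?P \<partial>Y)
      \<le> rate * (\<integral>y. y * (\<integral>w. f (w + y) - f w \<partial>W) \<partial>Y)"
    by (intro mult_left_mono integral_mono palm_diff(2)[OF _ B] integrable_mult_left
        Bochner_Integration.integrable_diff integrable_divide integrable_Y_sq integrable_trunc
        lower rate_nonneg) simp
  also have "\<dots> = (\<integral>w. w * f w \<partial>W)"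
    by (rule palm_diff(1)[symmetric, OF _ B]) simp
  also have "\<dots> \<le> (\<integral>w. \<bar>w\<bar> * h \<partial>W)"
  proof (intro integral_mono integrable_W_mult[OF _ B] integrable_mult_left integrable_abs integrable_W)
    fix w
    have "w * f w \<le> \<bar>w\<bar> * \<bar>f w\<bar>" by (metis abs_ge_self abs_mult)
    also have "\<dots> \<le> \<bar>w\<bar> * h" by (intro mult_left_mono B) simp
    finally show "w * f w \<le> \<bar>w\<bar> * h" .
  qed simp
  also have "\<dots> \<le> 1 * h"
    using h abs_moment_W by (simp add: mult_le_cancel_right)
  finally have "rate * (\<integral>y. (y\<^sup>2 - min (y\<^sup>2) (\<bar>y\<bar> ^ 3) / (4 * d)) * ?P \<partial>Y) \<le> h" by simp
  also have "(\<integral>y. (y\<^sup>2 - min (y\<^sup>2) (\<bar>y\<bar> ^ 3) / (4 * d)) * ?P \<partial>Y)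
      = ((\<integral>y. y\<^sup>2 \<partial>Y) - (\<integral>y. min (y\<^sup>2) (\<bar>y\<bar> ^ 3) \<partial>Y) / (4 * d)) * ?P"
    by (simp only: integral_mult_left_zero integral_divide_zero
        Bochner_Integration.integral_diff[OF integrable_Y_sq integrable_divide[OF integrable_trunc]])
  also have "rate * (((\<integral>y. y\<^sup>2 \<partial>Y) - (\<integral>y. min (y\<^sup>2) (\<bar>y\<bar> ^ 3) \<partial>Y) / (4 * d)) * ?P)
      = (rate * (\<integral>y. y\<^sup>2 \<partial>Y) - trunc_moment / (4 * d)) * ?P"
    by (simp add: trunc_moment_def algebra_simps)
  finally have *: "(1 - trunc_moment / (4 * d)) * ?P \<le> h"
    by (simp add: variance_Y)
  have "1 / 2 \<le> 1 - trunc_moment / (4 * d)"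
    using small d by (simp add: field_simps)
  then have "1 / 2 * ?P \<le> (1 - trunc_moment / (4 * d)) * ?P"
    by (intro mult_right_mono) auto
  also note *
  finally have "?P \<le> 2 * h" by simp
  also have "2 * h = b - a + 2 * d" by (simp add: h_def field_simps)
  finally show ?thesis .
qed

lemma normal_approximation_small:
  assumes l: "trunc_moment \<le> l" "0 < l" "l \<le> 1 / 2"
  shows "\<bar>cdf W z - Phi z\<bar> \<le> 7 / 2 * l"
proof -
  let ?f = "stein_sol z" and ?g = "stein_deriv z"
  have Bf: "\<bar>?f w\<bar> \<le> 2" for w using stein_sol_nonneg[of z w] stein_sol_le_2[of z w] by simp
  have Bg: "\<bar>?g w\<bar> \<le> 1" for w by (rule abs_stein_deriv_le_1)
  have int_g: "integrable W ?g"
    by (rule integrable_W_bounded[OF _ Bg]) simp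
  have int_f: "integrable W (\<lambda>w. ?f (w + y) - ?f w)" for y
    by (intro Bochner_Integration.integrable_diff integrable_shift[OF _ Bf]
        integrable_W_bounded[OF _ Bf]) simp_all
  \<comment> \<open>The Taylor remainder averaged over \<open>W\<close>. Because \<open>rate\<close>
    times the second moment of the jumps is 1, the expectation of \<open>?g\<close> equals the
    \<open>rate\<close>-weighted integral of y^2 times it, so its difference from the Palm
    expression is exactly an integral of \<open>y * R y\<close>.\<close>
  define R where "R y = (\<integral>w. y * ?g w - (?f (w + y) - ?f w) \<partial>W)" for y
  have int_R: "integrable W (\<lambda>w. y * ?g w - (?f (w + y) - ?f w))" for y
    by (intro Bochner_Integration.integrable_diff[OF integrable_mult_right] int_g int_f)
  have R_eq: "y * R y = y\<^sup>2 * (\<integral>w. ?g w \<partial>W) - y * (\<integral>w. ?f (w + y) - ?f w \<partial>W)" for y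
    unfolding R_def Bochner_Integration.integral_diff[OF integrable_mult_right[OF int_g] int_f]
    by (simp add: algebra_simps power2_eq_square)
  have int_D: "integrable Y (\<lambda>y. y * (\<integral>w. ?f (w + y) - ?f w \<partial>W))"
    by (rule palm_diff(2)[OF _ Bf]) simp
  have palm_f: "(\<integral>w. w * ?f w \<partial>W) = rate * (\<integral>y. y * (\<integral>w. ?f (w + y) - ?f w \<partial>W) \<partial>Y)"
    by (rule palm_diff(1)[OF _ Bf]) simp
  have int_wf: "integrable W (\<lambda>w. w * ?f w)"
    by (rule integrable_W_mult[OF _ Bf]) simp
  have intYR: "integrable Y (\<lambda>y. y * R y)"
    unfolding R_eq
    by (intro Bochner_Integration.integrable_diff integrable_mult_left integrable_Y_sq int_D)
  have "rate * (\<integral>y. y * R y \<partial>Y)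
      = rate * ((\<integral>y. y\<^sup>2 \<partial>Y) * (\<integral>w. ?g w \<partial>W) - (\<integral>y. y * (\<integral>w. ?f (w + y) - ?f w \<partial>W) \<partial>Y))"
    unfolding R_eq
    by (subst Bochner_Integration.integral_diff[OF integrable_mult_left[OF integrable_Y_sq] int_D])
      (simp only: integral_mult_left_zero)
  also have "\<dots> = rate * (\<integral>y. y\<^sup>2 \<partial>Y) * (\<integral>w. ?g w \<partial>W)
      - rate * (\<integral>y. y * (\<integral>w. ?f (w + y) - ?f w \<partial>W) \<partial>Y)"
    by (simp only: right_diff_distrib mult.assoc)
  also have "\<dots> = (\<integral>w. ?g w \<partial>W) - (\<integral>w. w * ?f w \<partial>W)"
    unfolding palm_f variance_Y by simp
  also have "\<dots> = (\<integral>w. ?g w - w * ?f w \<partial>W)"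
    by (rule Bochner_Integration.integral_diff[symmetric, OF int_g int_wf])
  also have "\<dots> = (\<integral>w. indicator {..z} w - Phi z \<partial>W)"
    by (rule Bochner_Integration.integral_cong) (auto simp: stein_deriv_def)
  also have "\<dots> = measure W {..z} - Phi z"
    by (subst Bochner_Integration.integral_diff)
      (auto simp: W.prob_space intro: integrable_W_bounded[where B = 1] simp: indicator_def)
  finally have error: "cdf W z - Phi z = rate * (\<integral>y. y * R y \<partial>Y)"
    by (simp add: cdf_def)
  have R1: "\<bar>R y\<bar> \<le> 2 * \<bar>y\<bar>" for y
  proof -
    have "\<bar>R y\<bar> \<le> (\<integral>w. \<bar>y * ?g w - (?f (w + y) - ?f w)\<bar> \<partial>W)"
      unfolding R_def by (rule integral_abs_bound)
    also have "\<dots> \<le> (\<integral>w. 2 * \<bar>y\<bar> \<partial>W)"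
    proof (intro integral_mono integrable_abs int_R)
      fix w
      have "\<bar>y * ?g w\<bar> \<le> \<bar>y\<bar> * 1" unfolding abs_mult by (intro mult_left_mono Bg) simp
      moreover have "\<bar>?f (w + y) - ?f w\<bar> \<le> \<bar>y\<bar>"
        using stein_sol_lipschitz[of z "w + y" w] by simp
      ultimately show "\<bar>y * ?g w - (?f (w + y) - ?f w)\<bar> \<le> 2 * \<bar>y\<bar>" by linarith
    qed simp
    finally show ?thesis by (simp add: W.prob_space)
  qed
  \<comment> \<open>5/2 = 3/2 + 1: the first part is half the expectation of |w| + 2, the second
    comes from the length |y| of the interval \<open>?I\<close>.\<close>
  have R2: "\<bar>R y\<bar> \<le> 5 / 2 * y\<^sup>2 + \<bar>y\<bar> * l" for y
  proof -
    let ?I = "{min z (z - y)..max z (z - y)}"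
    have int_I: "integrable W (\<lambda>w. \<bar>y\<bar> * indicator ?I w)"
      by (intro integrable_mult_right integrable_W_bounded[where B = 1]) (auto simp: indicator_def)
    have int_w: "integrable W (\<lambda>w. (\<bar>w\<bar> + 2) * y\<^sup>2 / 2)"
      by (intro integrable_divide integrable_mult_left Bochner_Integration.integrable_add
          integrable_abs integrable_W) simp
    have "\<bar>R y\<bar> \<le> (\<integral>w. \<bar>y * ?g w - (?f (w + y) - ?f w)\<bar> \<partial>W)"
      unfolding R_def by (rule integral_abs_bound)
    also have "\<dots> \<le> (\<integral>w. (\<bar>w\<bar> + 2) * y\<^sup>2 / 2 + \<bar>y\<bar> * indicator ?I w \<partial>W)"
      by (intro integral_mono integrable_abs int_R Bochner_Integration.integrable_add
          int_I int_w stein_sol_taylor)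
    also have "\<dots> = (\<integral>w. (\<bar>w\<bar> + 2) * y\<^sup>2 / 2 \<partial>W) + (\<integral>w. \<bar>y\<bar> * indicator ?I w \<partial>W)"
      by (intro Bochner_Integration.integral_add int_I int_w)
    finally have "\<bar>R y\<bar> \<le> (\<integral>w. (\<bar>w\<bar> + 2) * y\<^sup>2 / 2 \<partial>W) + \<bar>y\<bar> * measure W ?I"
      by simp
    moreover have "(\<integral>w. (\<bar>w\<bar> + 2) * y\<^sup>2 / 2 \<partial>W) \<le> 3 * y\<^sup>2 / 2"
    proof -
      have "(\<integral>w. \<bar>w\<bar> + 2 \<partial>W) = (\<integral>w. \<bar>w\<bar> \<partial>W) + 2"
        by (subst Bochner_Integration.integral_add) (use integrable_W in simp_all)
      then have "(\<integral>w. \<bar>w\<bar> + 2 \<partial>W) \<le> 3" using abs_moment_W by simp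
      then have "(\<integral>w. \<bar>w\<bar> + 2 \<partial>W) * y\<^sup>2 / 2 \<le> 3 * y\<^sup>2 / 2"
        by (intro divide_right_mono mult_right_mono) auto
      then show ?thesis by (simp only: integral_divide_zero integral_mult_left_zero)
    qed
    \<comment> \<open>The concentration inequality is taken with \<open>d = l / 2\<close>; its
      conditions then read \<open>l \<le> 1 / 2\<close> and
      \<open>trunc_moment \<le> l\<close>.\<close>
    moreover have "measure W ?I \<le> max z (z - y) - min z (z - y) + 2 * (l / 2)"
      using l by (intro concentration) auto
    then have "measure W ?I \<le> \<bar>y\<bar> + l" by (auto simp: max_def min_def split: if_splits)
    then have "\<bar>y\<bar> * measure W ?I \<le> \<bar>y\<bar> * (\<bar>y\<bar> + l)"
      by (rule mult_left_mono) simp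
    moreover have "\<bar>y\<bar> * (\<bar>y\<bar> + l) = y\<^sup>2 + \<bar>y\<bar> * l"
      by (simp add: distrib_left power2_eq_square)
    ultimately show ?thesis by linarith
  qed
  \<comment> \<open>Beyond |y| = 1 the Lipschitz bound \<open>R1\<close> yields 2 y^2, which the
    same factor 5/2 covers. The term \<open>l * y\<^sup>2\<close> later integrates to
    \<open>l\<close>, as the normalised variance is 1.\<close>
  have yR: "\<bar>y * R y\<bar> \<le> 5 / 2 * min (y\<^sup>2) (\<bar>y\<bar> ^ 3) + l * y\<^sup>2" for y
  proof (cases "\<bar>y\<bar> \<le> 1")
    case True
    have "\<bar>y\<bar> ^ 3 \<le> \<bar>y\<bar> ^ 2" using True by (intro power_decreasing) auto
    then have "min (y\<^sup>2) (\<bar>y\<bar> ^ 3) = \<bar>y\<bar> ^ 3" by simp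
    moreover have "\<bar>y * R y\<bar> \<le> \<bar>y\<bar> * (5 / 2 * y\<^sup>2 + \<bar>y\<bar> * l)"
      unfolding abs_mult by (intro mult_left_mono R2) simp
    moreover have "\<bar>y\<bar> * (5 / 2 * y\<^sup>2 + \<bar>y\<bar> * l) = 5 / 2 * \<bar>y\<bar> ^ 3 + l * y\<^sup>2"
      by (simp add: algebra_simps power3_eq_cube power2_eq_square abs_if)
    ultimately show ?thesis by linarith
  next
    case False
    have "\<bar>y\<bar> ^ 2 \<le> \<bar>y\<bar> ^ 3" using False by (intro power_increasing) auto
    then have "min (y\<^sup>2) (\<bar>y\<bar> ^ 3) = y\<^sup>2" by simp
    moreover have "\<bar>y * R y\<bar> \<le> \<bar>y\<bar> * (2 * \<bar>y\<bar>)"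
      unfolding abs_mult by (intro mult_left_mono R1) simp
    moreover have "\<bar>y\<bar> * (2 * \<bar>y\<bar>) = 2 * y\<^sup>2" by (simp add: power2_eq_square)
    moreover have "0 \<le> l * y\<^sup>2" using l by simp
    moreover have "0 \<le> y\<^sup>2" by simp
    ultimately show ?thesis by linarith
  qed
  have "\<bar>cdf W z - Phi z\<bar> = rate * \<bar>\<integral>y. y * R y \<partial>Y\<bar>"
    by (simp add: error abs_mult rate_nonneg)
  also have "\<dots> \<le> rate * (\<integral>y. \<bar>y * R y\<bar> \<partial>Y)"
    by (intro mult_left_mono integral_abs_bound rate_nonneg)
  also have "\<dots> \<le> rate * (\<integral>y. 5 / 2 * min (y\<^sup>2) (\<bar>y\<bar> ^ 3) + l * y\<^sup>2 \<partial>Y)"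
    by (intro mult_left_mono integral_mono integrable_abs intYR yR rate_nonneg
        Bochner_Integration.integrable_add integrable_mult_right integrable_trunc integrable_Y_sq)
  also have "\<dots> = 5 / 2 * trunc_moment + l * (rate * (\<integral>y. y\<^sup>2 \<partial>Y))"
    using integrable_trunc integrable_Y_sq by (simp add: trunc_moment_def algebra_simps)
  also have "\<dots> \<le> 7 / 2 * l"
    using l by (simp add: variance_Y)
  finally show ?thesis .
qed

text \<open>From 1/2 on the bound exceeds 1 and is trivial. Below, the slack \<open>e\<close>
  supplies the positive level \<open>l\<close> that the concentration inequality needs, so it is
  enough to know that \<open>trunc_moment\<close> is nonnegative.\<close>

theorem normal_approximation: "\<bar>cdf W z - Phi z\<bar> \<le> 7 / 2 * trunc_moment"
proof (cases "trunc_moment < 1 / 2")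
  case True
  show ?thesis
  proof (rule field_le_epsilon)
    fix e :: real assume "0 < e"
    have nonneg: "0 \<le> trunc_moment"
      unfolding trunc_moment_def by (intro mult_nonneg_nonneg rate_nonneg integral_nonneg_AE) auto
    let ?l = "min (1 / 2) (trunc_moment + e / 4)"
    have "\<bar>cdf W z - Phi z\<bar> \<le> 7 / 2 * ?l"
      using True \<open>0 < e\<close> nonneg
      by (intro normal_approximation_small min.cobounded1) auto
    also have "\<dots> \<le> 7 / 2 * (trunc_moment + e / 4)"
      by (intro mult_left_mono min.cobounded2) simp
    finally show "\<bar>cdf W z - Phi z\<bar> \<le> 7 / 2 * trunc_moment + e" using \<open>0 < e\<close> by simp
  qed
next
  case False
  have "0 \<le> cdf W z" "cdf W z \<le> 1" by (simp_all add: cdf_def)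
  then have "\<bar>cdf W z - Phi z\<bar> \<le> 1" using Phi_le_1[of z] Phi_ge_0[of z] by linarith
  with False show ?thesis by simp
qed

lemma real_distribution_W: "real_distribution W"
  by unfold_locales simp_all

text \<open>Closed intervals require the mass strictly below the left endpoint, which may be an atom
  of \<open>W\<close>. The bound passes to left limits because \<open>Phi\<close> is
  continuous.\<close>

lemma normal_approximation_less: "\<bar>measure W {..<a} - Phi a\<bar> \<le> 7 / 2 * trunc_moment"
proof (rule tendsto_upperbound)
  interpret D: real_distribution W by (rule real_distribution_W)
  have "(Phi \<longlongrightarrow> Phi a) (at_left a)"
    using isCont_Phi[of a] by (simp add: continuous_at filterlim_at_split)
  with D.cdf_at_left show "((\<lambda>x. \<bar>cdf W x - Phi x\<bar>) \<longlongrightarrow> \<bar>measure W {..<a} - Phi a\<bar>) (at_left a)"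
    by (intro tendsto_rabs tendsto_diff)
  show "\<forall>\<^sub>F x in at_left a. \<bar>cdf W x - Phi x\<bar> \<le> 7 / 2 * trunc_moment"
    by (intro always_eventually allI normal_approximation)
qed simp

lemma normal_approximation_interval:
  assumes "a \<le> b"
  shows "\<bar>measure W {a..b} - (Phi b - Phi a)\<bar> \<le> 7 * trunc_moment"
proof -
  have "{..b} = {..<a} \<union> {a..b}" using assms by auto
  then have "measure W {..b} = measure W ({..<a} \<union> {a..b})" by (rule arg_cong)
  also have "\<dots> = measure W {..<a} + measure W {a..b}"
    by (rule W.finite_measure_Union) auto
  finally have "measure W {..b} = measure W {..<a} + measure W {a..b}" .
  then have "measure W {a..b} - (Phi b - Phi a) = (cdf W b - Phi b) - (measure W {..<a} - Phi a)"
    by (simp add: cdf_def)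
  then show ?thesis
    using normal_approximation[of b] normal_approximation_less[of a] by linarith
qed

end

subsection \<open>Compound Poisson sums\<close>

lemma integrable_nat_pmf_iff:
  fixes h :: "nat \<Rightarrow> real"
  shows "integrable (measure_pmf p) h \<longleftrightarrow> summable (\<lambda>k. pmf p k * \<bar>h k\<bar>)"
proof -
  have "integrable (measure_pmf p) h \<longleftrightarrow> integrable (count_space UNIV) (\<lambda>k. pmf p k *\<^sub>R h k)"
    unfolding measure_pmf_eq_density by (intro integrable_density) auto
  then show ?thesis
    by (simp add: integrable_count_space_nat_iff abs_mult)
qed

lemma nat_pmf_sums_integral:
  fixes h :: "nat \<Rightarrow> real"
  assumes "integrable (measure_pmf p) h"
  shows "(\<lambda>k. pmf p k * h k) sums (\<integral>k. h k \<partial>measure_pmf p)"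
proof -
  have "integrable (count_space UNIV) (\<lambda>k. pmf p k *\<^sub>R h k)"
    using assms unfolding measure_pmf_eq_density by (subst (asm) integrable_density) auto
  then have "(\<lambda>k. pmf p k * h k) sums (\<integral>k. pmf p k * h k \<partial>count_space UNIV)"
    by (intro sums_integral_count_space_nat) simp
  also have "(\<integral>k. pmf p k * h k \<partial>count_space UNIV) = (\<integral>k. h k \<partial>measure_pmf p)"
    unfolding measure_pmf_eq_density by (subst integral_density) auto
  finally show ?thesis .
qed

text \<open>The Poisson recursion \<open>(k + 1) p (k + 1) = rate * p k\<close>, summed against
  \<open>c\<close>. At k = 0 the factor \<open>real k\<close> removes the term with the truncated
  subtraction \<open>0 - 1\<close>.\<close>

lemma poisson_size_bias:
  fixes c :: "nat \<Rightarrow> real"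
  assumes rate: "0 < rate" and B: "\<And>k. \<bar>c k\<bar> \<le> B"
  shows "integrable (measure_pmf (poisson_pmf rate)) (\<lambda>k. real k * c (k - 1))"
    and "(\<integral>k. real k * c (k - 1) \<partial>measure_pmf (poisson_pmf rate))
      = rate * (\<integral>k. c k \<partial>measure_pmf (poisson_pmf rate))"
proof -
  let ?p = "pmf (poisson_pmf rate)"
  have shift: "?p (Suc k) * (real (Suc k) * t) = rate * (?p k * t)" for k t
  proof -
    have "?p (Suc k) * real (Suc k) = rate * ?p k"
      using rate by (simp add: divide_simps)
    then show ?thesis by (metis mult.assoc)
  qed
  have c: "integrable (measure_pmf (poisson_pmf rate)) c"
    by (rule measure_pmf.integrable_const_bound[where B = B]) (auto simp: B)
  have "summable (\<lambda>k. rate * (?p k * \<bar>c k\<bar>))"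
    using c by (intro summable_mult) (simp only: integrable_nat_pmf_iff)
  then have "summable (\<lambda>k. ?p (Suc k) * (real (Suc k) * \<bar>c k\<bar>))"
    by (simp only: shift)
  then have "summable (\<lambda>k. ?p (Suc k) * \<bar>real (Suc k) * c (Suc k - 1)\<bar>)"
    by (simp add: abs_mult)
  then show int: "integrable (measure_pmf (poisson_pmf rate)) (\<lambda>k. real k * c (k - 1))"
    unfolding integrable_nat_pmf_iff by (subst (asm) summable_Suc_iff)
  have "(\<lambda>k. rate * (?p k * c k)) sums (rate * (\<integral>k. c k \<partial>measure_pmf (poisson_pmf rate)))"
    by (intro sums_mult nat_pmf_sums_integral c)
  then have "(\<lambda>k. ?p (Suc k) * (real (Suc k) * c (Suc k - 1))) sums
      (rate * (\<integral>k. c k \<partial>measure_pmf (poisson_pmf rate)))"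
    by (simp only: shift diff_Suc_1)
  then have "(\<lambda>k. ?p k * (real k * c (k - 1))) sums
      (rate * (\<integral>k. c k \<partial>measure_pmf (poisson_pmf rate)))"
    by (subst (asm) sums_Suc_iff) simp
  with nat_pmf_sums_integral[OF int]
  show "(\<integral>k. real k * c (k - 1) \<partial>measure_pmf (poisson_pmf rate))
      = rate * (\<integral>k. c k \<partial>measure_pmf (poisson_pmf rate))"
    by (rule sums_unique2)
qed

lemma measurable_pmf_pair:
  fixes p :: "'b::countable pmf"
  assumes "\<And>k. (\<lambda>x. f (k, x)) \<in> measurable N L"
  shows "f \<in> measurable (measure_pmf p \<Otimes>\<^sub>M N) L"
proof -
  have "f \<in> measurable (count_space UNIV \<Otimes>\<^sub>M N) L"
    using assms by (intro measurable_pair_measure_countable1) auto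
  moreover have "sets (measure_pmf p \<Otimes>\<^sub>M N) = sets (count_space UNIV \<Otimes>\<^sub>M N)"
    by (intro sets_pair_measure_cong) simp_all
  ultimately show ?thesis by (simp cong: measurable_cong_sets)
qed

section \<open>The Palm identity for compound Poisson sums of an iid sequence\<close>

locale iid_sequence = prob_space M for M :: "'a measure" +
  fixes X :: "nat \<Rightarrow> 'a \<Rightarrow> real"
  assumes indep_X: "indep_vars (\<lambda>_. borel) X UNIV"
    and ident_X: "distr M borel (X i) = distr M borel (X 0)"
    and integrable_X0: "integrable M (X 0)"
begin

definition law :: "real measure" where "law = distr M borel (X 0)"

definition S :: "nat \<Rightarrow> 'a \<Rightarrow> real" where "S k \<omega> = (\<Sum>i<k. X i \<omega>)"

lemma X_measurable [measurable]: "X i \<in> borel_measurable M"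
  using indep_X by (auto simp: indep_vars_def)

lemma S_measurable [measurable]: "S k \<in> borel_measurable M"
  unfolding S_def by measurable

lemma sets_law [measurable_cong, simp]: "sets law = sets borel"
  by (simp add: law_def)

sublocale law: prob_space law
  unfolding law_def by (rule prob_space_distr) simp

lemma integral_law:
  fixes h :: "real \<Rightarrow> real"
  assumes [measurable]: "h \<in> borel_measurable borel"
  shows "(\<integral>y. h y \<partial>law) = (\<integral>\<omega>. h (X i \<omega>) \<partial>M)"
  unfolding law_def ident_X[of i, symmetric] by (rule integral_distr) simp_all

lemma integrable_law:
  fixes h :: "real \<Rightarrow> real"
  assumes [measurable]: "h \<in> borel_measurable borel"
  shows "integrable law h \<longleftrightarrow> integrable M (\<lambda>\<omega>. h (X i \<omega>))"
  unfolding law_def ident_X[of i, symmetric] by (rule integrable_distr_eq) simp_all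

lemma integrable_law_id: "integrable law (\<lambda>y. y)"
  using integrable_X0 by (subst integrable_law[of _ 0]) auto

lemma integrable_X: "integrable M (X i)"
  using integrable_law_id by (subst (asm) integrable_law[of _ i]) auto

lemma integrable_S: "integrable M (S k)"
  unfolding S_def using integrable_X by simp

text \<open>\<open>S k\<close> sums the indices below \<open>k\<close>, so \<open>X k\<close> is a
  fresh summand.\<close>

lemma joint_law: "law \<Otimes>\<^sub>M distr M borel (S k) = distr M (borel \<Otimes>\<^sub>M borel) (\<lambda>\<omega>. (X k \<omega>, S k \<omega>))"
proof -
  have "indep_var borel (X k) borel (\<lambda>\<omega>. \<Sum>i\<in>{..<k}. X i \<omega>)"
    by (intro indep_vars_sum indep_vars_subset[OF indep_X]) auto
  then have "indep_var borel (X k) borel (S k)"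
    unfolding S_def[abs_def] .
  then have "distr M borel (X k) \<Otimes>\<^sub>M distr M borel (S k)
      = distr M (borel \<Otimes>\<^sub>M borel) (\<lambda>\<omega>. (X k \<omega>, S k \<omega>))"
    by (subst (asm) indep_var_distribution_eq) auto
  then show ?thesis unfolding law_def ident_X[of k] .
qed

lemma expectation_S_X:
  fixes h :: "real \<Rightarrow> real \<Rightarrow> real"
  assumes [measurable]: "case_prod h \<in> borel_measurable (borel \<Otimes>\<^sub>M borel)"
    and int: "integrable M (\<lambda>\<omega>. h (S k \<omega>) (X k \<omega>))"
  shows "(\<integral>\<omega>. h (S k \<omega>) (X k \<omega>) \<partial>M) = (\<integral>y. (\<integral>\<omega>. h (S k \<omega>) y \<partial>M) \<partial>law)"
proof -
  let ?D = "distr M borel (S k)"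
  interpret D: prob_space ?D by (rule prob_space_distr) simp
  interpret P: pair_sigma_finite law ?D ..
  let ?h = "\<lambda>z. case_prod h (snd z, fst z)"
  have [measurable]: "?h \<in> borel_measurable (borel \<Otimes>\<^sub>M borel)" by measurable
  have eq: "(\<integral>s. h s y \<partial>?D) = (\<integral>\<omega>. h (S k \<omega>) y \<partial>M)" for y
    by (rule integral_distr) simp_all
  have "integrable (law \<Otimes>\<^sub>M ?D) ?h"
    unfolding joint_law using int by (subst integrable_distr_eq) simp_all
  then have int': "integrable (law \<Otimes>\<^sub>M ?D) (\<lambda>(y, s). h s y)"
    by (simp add: split_beta')
  have "(\<integral>\<omega>. h (S k \<omega>) (X k \<omega>) \<partial>M) = (\<integral>z. ?h z \<partial>(law \<Otimes>\<^sub>M ?D))"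
    unfolding joint_law by (subst integral_distr) simp_all
  also have "\<dots> = (\<integral>(y, s). h s y \<partial>(law \<Otimes>\<^sub>M ?D))"
    by (simp add: split_beta')
  also have "\<dots> = (\<integral>y. (\<integral>s. h s y \<partial>?D) \<partial>law)"
    by (rule P.integral_fst[symmetric, OF int'])
  finally show "(\<integral>\<omega>. h (S k \<omega>) (X k \<omega>) \<partial>M) = (\<integral>y. (\<integral>\<omega>. h (S k \<omega>) y \<partial>M) \<partial>law)"
    by (simp only: eq)
qed

text \<open>Each of the \<open>k\<close> summands contributes equally to the factor
  \<open>S k\<close>. Induction replaces the appeal to exchangeability: the last summand contributes
  its own term directly, and the other \<open>k\<close> are handled by the hypothesis with the last
  summand frozen at \<open>y\<close>.\<close>

lemma palm_sum:
  fixes f :: "real \<Rightarrow> real"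
  assumes "f \<in> borel_measurable borel" and "\<And>w. \<bar>f w\<bar> \<le> B"
  shows "(\<integral>\<omega>. S k \<omega> * f (S k \<omega>) \<partial>M)
    = real k * (\<integral>y. y * (\<integral>\<omega>. f (S (k - 1) \<omega> + y) \<partial>M) \<partial>law)"
  using assms
proof (induction k arbitrary: f)
  case 0
  then show ?case by (simp add: S_def)
next
  case (Suc k)
  note [measurable] = Suc.prems(1) and B = Suc.prems(2)
  have S_Suc: "S (Suc k) \<omega> = S k \<omega> + X k \<omega>" for \<omega> by (simp add: S_def)
  have i1: "integrable M (\<lambda>\<omega>. S k \<omega> * f (S k \<omega> + X k \<omega>))"
    by (rule integrable_mult_bounded[OF integrable_S _ B]) measurable
  have i2: "integrable M (\<lambda>\<omega>. X k \<omega> * f (S k \<omega> + X k \<omega>))"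
    by (rule integrable_mult_bounded[OF integrable_X _ B]) measurable
  have "(\<integral>\<omega>. S (Suc k) \<omega> * f (S (Suc k) \<omega>) \<partial>M)
      = (\<integral>\<omega>. S k \<omega> * f (S k \<omega> + X k \<omega>) \<partial>M) + (\<integral>\<omega>. X k \<omega> * f (S k \<omega> + X k \<omega>) \<partial>M)"
    unfolding S_Suc distrib_right by (rule Bochner_Integration.integral_add[OF i1 i2])
  also have "(\<integral>\<omega>. X k \<omega> * f (S k \<omega> + X k \<omega>) \<partial>M)
      = (\<integral>y. y * (\<integral>\<omega>. f (S k \<omega> + y) \<partial>M) \<partial>law)"
    by (subst expectation_S_X[OF _ i2]) simp_all
  also have "(\<integral>\<omega>. S k \<omega> * f (S k \<omega> + X k \<omega>) \<partial>M)
      = (\<integral>y. (\<integral>\<omega>. S k \<omega> * f (S k \<omega> + y) \<partial>M) \<partial>law)"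
    by (subst expectation_S_X[OF _ i1]) simp_all
  also have "(\<integral>y. (\<integral>\<omega>. S k \<omega> * f (S k \<omega> + y) \<partial>M) \<partial>law)
      = real k * (\<integral>y. y * (\<integral>\<omega>. f (S k \<omega> + y) \<partial>M) \<partial>law)"
  proof (cases k)
    case 0
    then show ?thesis by (simp add: S_def)
  next
    case (Suc j)
    have IH: "(\<integral>\<omega>. S k \<omega> * f (S k \<omega> + y) \<partial>M)
        = real k * (\<integral>x. x * (\<integral>\<omega>. f (S j \<omega> + x + y) \<partial>M) \<partial>law)" for y
      using Suc.IH[of "\<lambda>w. f (w + y)"] B Suc by simp
    interpret LL: pair_sigma_finite law law ..
    have bnd: "\<bar>\<integral>\<omega>. f (S j \<omega> + x + y) \<partial>M\<bar> \<le> B" for x y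
      by (rule abs_expectation_le) (rule B)
    have int: "integrable (law \<Otimes>\<^sub>M law) (\<lambda>(x, y). x * (\<integral>\<omega>. f (S j \<omega> + x + y) \<partial>M))"
    proof -
      have "integrable (law \<Otimes>\<^sub>M law) (\<lambda>z. fst z * (\<integral>\<omega>. f (S j \<omega> + fst z + snd z) \<partial>M))"
      proof (rule integrable_mult_bounded[OF _ _ bnd])
        show "integrable (law \<Otimes>\<^sub>M law) fst"
        proof (rule LL.Fubini_integrable)
          show "integrable law (\<lambda>x. \<integral>y. norm (fst (x, y)) \<partial>law)"
            using integrable_law_id by simp
        qed simp_all
      qed measurable
      then show ?thesis by (simp add: split_beta')
    qed
    have step: "(\<integral>y. (\<integral>\<omega>. f (S j \<omega> + x + y) \<partial>M) \<partial>law) = (\<integral>\<omega>. f (S k \<omega> + x) \<partial>M)" for x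
    proof -
      have "integrable M (\<lambda>\<omega>. f (S j \<omega> + x + X j \<omega>))"
        by (rule integrable_const_bound[where B = B]) (auto simp: B)
      from expectation_S_X[OF _ this]
      have "(\<integral>\<omega>. f (S j \<omega> + x + X j \<omega>) \<partial>M) = (\<integral>y. (\<integral>\<omega>. f (S j \<omega> + x + y) \<partial>M) \<partial>law)"
        by simp
      moreover have "S j \<omega> + x + X j \<omega> = S k \<omega> + x" for \<omega> by (simp add: Suc S_def)
      ultimately show ?thesis by simp
    qed
    have "(\<integral>y. (\<integral>\<omega>. S k \<omega> * f (S k \<omega> + y) \<partial>M) \<partial>law)
        = real k * (\<integral>y. (\<integral>x. x * (\<integral>\<omega>. f (S j \<omega> + x + y) \<partial>M) \<partial>law) \<partial>law)"
      unfolding IH by simp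
    also have "(\<integral>y. (\<integral>x. x * (\<integral>\<omega>. f (S j \<omega> + x + y) \<partial>M) \<partial>law) \<partial>law)
        = (\<integral>x. (\<integral>y. x * (\<integral>\<omega>. f (S j \<omega> + x + y) \<partial>M) \<partial>law) \<partial>law)"
      by (rule LL.Fubini_integral[OF int])
    also have "\<dots> = (\<integral>x. x * (\<integral>\<omega>. f (S k \<omega> + x) \<partial>M) \<partial>law)"
      by (simp add: step)
    finally show ?thesis .
  qed
  finally show ?case by (simp add: algebra_simps)
qed

text \<open>The product space supplies a Poisson count that is independent of the whole
  sequence.\<close>

definition cpois :: "real \<Rightarrow> real measure" where
  "cpois rate = distr (measure_pmf (poisson_pmf rate) \<Otimes>\<^sub>M M) borel (\<lambda>(k, \<omega>). S k \<omega>)"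

lemma S_pair_measurable:
  "(\<lambda>(k, \<omega>). S k \<omega>) \<in> borel_measurable (measure_pmf (poisson_pmf rate) \<Otimes>\<^sub>M M)"
  by (rule measurable_pmf_pair) simp

lemma sets_cpois [measurable_cong, simp]: "sets (cpois rate) = sets borel"
  by (simp add: cpois_def)

lemma prob_space_cpois: "prob_space (cpois rate)"
proof -
  interpret P: pair_prob_space "measure_pmf (poisson_pmf rate)" M ..
  show ?thesis unfolding cpois_def by (rule P.prob_space_distr[OF S_pair_measurable])
qed

lemma integral_cpois:
  fixes h :: "real \<Rightarrow> real"
  assumes h: "h \<in> borel_measurable borel" and int: "integrable (cpois rate) h"
  shows "(\<integral>w. h w \<partial>cpois rate) = (\<integral>k. (\<integral>\<omega>. h (S k \<omega>) \<partial>M) \<partial>measure_pmf (poisson_pmf rate))"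
proof -
  interpret P: pair_prob_space "measure_pmf (poisson_pmf rate)" M ..
  have int': "integrable (measure_pmf (poisson_pmf rate) \<Otimes>\<^sub>M M) (\<lambda>(k, \<omega>). h (S k \<omega>))"
    using int unfolding cpois_def
    by (subst (asm) integrable_distr_eq[OF S_pair_measurable h]) (simp add: split_beta')
  have "(\<integral>w. h w \<partial>cpois rate)
      = (\<integral>z. (\<lambda>(k, \<omega>). h (S k \<omega>)) z \<partial>(measure_pmf (poisson_pmf rate) \<Otimes>\<^sub>M M))"
    unfolding cpois_def by (subst integral_distr[OF S_pair_measurable h]) (simp add: split_beta')
  also have "\<dots> = (\<integral>k. (\<integral>\<omega>. h (S k \<omega>) \<partial>M) \<partial>measure_pmf (poisson_pmf rate))"
    by (rule P.integral_fst[symmetric, OF int'])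
  finally show ?thesis .
qed

text \<open>The expectation of |S k| grows at most linearly in \<open>k\<close>, and the Poisson
  mean is finite by the size-bias lemma for constant \<open>c\<close>.\<close>

lemma integrable_cpois:
  assumes rate: "0 < rate"
  shows "integrable (cpois rate) (\<lambda>w. w)"
proof -
  interpret P: pair_prob_space "measure_pmf (poisson_pmf rate)" M ..
  let ?p = "measure_pmf (poisson_pmf rate)"
  have bnd: "(\<integral>\<omega>. \<bar>S k \<omega>\<bar> \<partial>M) \<le> real k * (\<integral>y. \<bar>y\<bar> \<partial>law)" for k
  proof -
    have "(\<integral>\<omega>. \<bar>S k \<omega>\<bar> \<partial>M) \<le> (\<integral>\<omega>. (\<Sum>i<k. \<bar>X i \<omega>\<bar>) \<partial>M)"
      unfolding S_def using integrable_X by (intro integral_mono) (auto intro: integrable_abs)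
    also have "\<dots> = (\<Sum>i<k. \<integral>\<omega>. \<bar>X i \<omega>\<bar> \<partial>M)"
      using integrable_X by (intro Bochner_Integration.integral_sum integrable_abs)
    also have "\<dots> = (\<Sum>i<k. \<integral>y. \<bar>y\<bar> \<partial>law)"
      by (intro sum.cong refl integral_law[symmetric]) simp
    finally show ?thesis by simp
  qed
  have "integrable ?p (\<lambda>k. real k * (\<integral>y. \<bar>y\<bar> \<partial>law))"
    using poisson_size_bias(1)[OF rate, of "\<lambda>_. \<integral>y. \<bar>y\<bar> \<partial>law"] by auto
  then have "integrable ?p (\<lambda>k. \<integral>\<omega>. \<bar>S k \<omega>\<bar> \<partial>M)"
    by (rule Bochner_Integration.integrable_bound) (auto simp: bnd)
  then have "integrable (?p \<Otimes>\<^sub>M M) (\<lambda>(k, \<omega>). S k \<omega>)"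
    using integrable_S by (intro P.Fubini_integrable S_pair_measurable) auto
  then show ?thesis
    unfolding cpois_def by (subst integrable_distr_eq[OF S_pair_measurable]) auto
qed

text \<open>\<open>palm_sum\<close> produces \<open>real k * c (k - 1)\<close>, and the Poisson size
  bias turns this into \<open>rate * c k\<close>: the summand lost in the finite identity
  returns.\<close>

lemma palm_cpois:
  fixes f :: "real \<Rightarrow> real"
  assumes rate: "0 < rate" and [measurable]: "f \<in> borel_measurable borel" and B: "\<And>w. \<bar>f w\<bar> \<le> B"
  shows "(\<integral>w. w * f w \<partial>cpois rate) = rate * (\<integral>y. y * (\<integral>w. f (w + y) \<partial>cpois rate) \<partial>law)"
proof -
  let ?p = "measure_pmf (poisson_pmf rate)"
  interpret C: prob_space "cpois rate" by (rule prob_space_cpois)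
  interpret P: pair_sigma_finite ?p law ..
  define c where "c k = (\<integral>y. y * (\<integral>\<omega>. f (S k \<omega> + y) \<partial>M) \<partial>law)" for k
  have bnd: "\<bar>\<integral>\<omega>. f (S k \<omega> + y) \<partial>M\<bar> \<le> B" for k y
    by (rule abs_expectation_le) (rule B)
  have c: "\<bar>c k\<bar> \<le> (\<integral>y. \<bar>y\<bar> * B \<partial>law)" for k
  proof -
    have "\<bar>c k\<bar> \<le> (\<integral>y. \<bar>y * (\<integral>\<omega>. f (S k \<omega> + y) \<partial>M)\<bar> \<partial>law)"
      unfolding c_def by (rule integral_abs_bound)
    also have "\<dots> \<le> (\<integral>y. \<bar>y\<bar> * B \<partial>law)"
    proof (rule integral_mono)
      show "integrable law (\<lambda>y. \<bar>y * (\<integral>\<omega>. f (S k \<omega> + y) \<partial>M)\<bar>)"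
        by (intro integrable_abs integrable_mult_bounded[OF integrable_law_id _ bnd]) measurable
      show "integrable law (\<lambda>y. \<bar>y\<bar> * B)"
        using integrable_law_id by (intro integrable_mult_left integrable_abs)
      fix y show "\<bar>y * (\<integral>\<omega>. f (S k \<omega> + y) \<partial>M)\<bar> \<le> \<bar>y\<bar> * B"
        unfolding abs_mult by (intro mult_left_mono bnd) simp
    qed
    finally show ?thesis .
  qed
  have int: "integrable (?p \<Otimes>\<^sub>M law) (\<lambda>(k, y). y * (\<integral>\<omega>. f (S k \<omega> + y) \<partial>M))"
  proof -
    have "integrable (?p \<Otimes>\<^sub>M law) (\<lambda>z. snd z * (\<integral>\<omega>. f (S (fst z) \<omega> + snd z) \<partial>M))"
    proof (rule integrable_mult_bounded[OF _ _ bnd])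
      show "integrable (?p \<Otimes>\<^sub>M law) snd"
        using integrable_law_id by (intro P.Fubini_integrable) simp_all
      show "(\<lambda>z. \<integral>\<omega>. f (S (fst z) \<omega> + snd z) \<partial>M) \<in> borel_measurable (?p \<Otimes>\<^sub>M law)"
        by (rule measurable_pmf_pair) simp
    qed
    then show ?thesis by (simp add: split_beta')
  qed
  have "(\<integral>w. w * f w \<partial>cpois rate) = (\<integral>k. (\<integral>\<omega>. S k \<omega> * f (S k \<omega>) \<partial>M) \<partial>?p)"
    by (intro integral_cpois integrable_mult_bounded[OF integrable_cpois[OF rate] _ B]) simp_all
  also have "\<dots> = (\<integral>k. real k * c (k - 1) \<partial>?p)"
    by (simp only: palm_sum[OF \<open>f \<in> _\<close> B] c_def)
  also have "\<dots> = rate * (\<integral>k. c k \<partial>?p)"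
    by (rule poisson_size_bias(2)[OF rate c])
  also have "(\<integral>k. c k \<partial>?p) = (\<integral>y. (\<integral>k. y * (\<integral>\<omega>. f (S k \<omega> + y) \<partial>M) \<partial>?p) \<partial>law)"
    unfolding c_def by (rule P.Fubini_integral[symmetric, OF int])
  also have "\<dots> = (\<integral>y. y * (\<integral>w. f (w + y) \<partial>cpois rate) \<partial>law)"
  proof -
    have "(\<integral>w. f (w + y) \<partial>cpois rate) = (\<integral>k. (\<integral>\<omega>. f (S k \<omega> + y) \<partial>M) \<partial>?p)" for y
      by (rule integral_cpois) (auto intro!: C.integrable_const_bound[where B = B] simp: B)
    then show ?thesis by simp
  qed
  finally show ?thesis .
qed

lemma measure_cpois_Icc:
  "measure (cpois rate) {a..b}
    = (\<integral>k. measure M {\<omega> \<in> space M. a \<le> S k \<omega> \<and> S k \<omega> \<le> b} \<partial>measure_pmf (poisson_pmf rate))"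
proof -
  interpret C: prob_space "cpois rate" by (rule prob_space_cpois)
  have prob_eq: "(\<integral>\<omega>. indicator {a..b} (S k \<omega>) \<partial>M)
      = measure M {\<omega> \<in> space M. a \<le> S k \<omega> \<and> S k \<omega> \<le> b}" for k
  proof -
    have "(\<integral>\<omega>. indicator {a..b} (S k \<omega>) \<partial>M)
        = (\<integral>\<omega>. indicat_real {\<omega> \<in> space M. a \<le> S k \<omega> \<and> S k \<omega> \<le> b} \<omega> \<partial>M)"
      by (intro Bochner_Integration.integral_cong) (auto simp: indicator_def)
    then show ?thesis by (simp add: Int_absorb1)
  qed
  have "measure (cpois rate) {a..b} = (\<integral>w. indicator {a..b} w \<partial>cpois rate)"
    by simp
  also have "\<dots> = (\<integral>k. (\<integral>\<omega>. indicator {a..b} (S k \<omega>) \<partial>M) \<partial>measure_pmf (poisson_pmf rate))"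
    by (intro integral_cpois C.integrable_const_bound[where B = 1]) (auto simp: indicator_def)
  finally show ?thesis unfolding prob_eq .
qed

lemma cpois_normal_approximation:
  assumes rate: "0 < rate" and sq: "integrable law (\<lambda>y. y\<^sup>2)"
    and mean: "(\<integral>y. y \<partial>law) = 0" and var: "rate * (\<integral>y. y\<^sup>2 \<partial>law) = 1" and "a \<le> b"
  shows "\<bar>measure (cpois rate) {a..b} - (Phi b - Phi a)\<bar>
    \<le> 7 * (rate * (\<integral>y. min (y\<^sup>2) (\<bar>y\<bar> ^ 3) \<partial>law))"
proof -
  interpret C: prob_space "cpois rate" by (rule prob_space_cpois)
  interpret centred_palm "cpois rate" law rate
  proof
    show "(\<integral>w. w * f w \<partial>cpois rate) = rate * (\<integral>y. y * (\<integral>w. f (w + y) \<partial>cpois rate) \<partial>law)"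
      if "f \<in> borel_measurable borel" "\<And>w. \<bar>f w\<bar> \<le> B" for f B
      using that by (rule palm_cpois[OF rate])
  qed (use assms integrable_cpois in auto)
  show ?thesis
    using normal_approximation_interval[OF \<open>a \<le> b\<close>] by (simp only: trunc_moment_def)
qed

end

text \<open>Jumps divided by \<open>s\<close> have second moment \<open>1 / rate\<close>, which is
  the normalisation required of \<open>centred_palm\<close>.\<close>

lemma poisson_sum_normal_approximation:
  fixes X :: "nat \<Rightarrow> 'a \<Rightarrow> real"
  assumes "prob_space M"
    and indep: "prob_space.indep_vars M (\<lambda>_. borel) X UNIV"
    and ident: "\<And>i. distr M borel (X i) = distr M borel (X 0)"
    and mean: "(\<integral>\<omega>. X 0 \<omega> \<partial>M) = 0"
    and sq: "integrable M (\<lambda>\<omega>. (X 0 \<omega>)\<^sup>2)"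
    and var: "(\<integral>\<omega>. (X 0 \<omega>)\<^sup>2 \<partial>M) = \<sigma>\<^sup>2"
    and "0 < \<sigma>" and rate: "0 < rate" and "a \<le> b"
  defines "s \<equiv> \<sigma> * sqrt rate"
  shows "\<bar>(\<integral>k. measure M {\<omega> \<in> space M. a \<le> (\<Sum>i<k. X i \<omega>) \<and> (\<Sum>i<k. X i \<omega>) \<le> b}
        \<partial>measure_pmf (poisson_pmf rate)) - (Phi (b / s) - Phi (a / s))\<bar>
    \<le> 7 * (rate * (\<integral>\<omega>. min ((X 0 \<omega> / s)\<^sup>2) (\<bar>X 0 \<omega> / s\<bar> ^ 3) \<partial>M))"
proof -
  interpret prob_space M by fact
  have X [measurable]: "X i \<in> borel_measurable M" for i
    using indep by (auto simp: indep_vars_def)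
  have s: "0 < s" using \<open>0 < \<sigma>\<close> rate by (simp add: s_def)
  have int0: "integrable M (X 0)"
    by (rule square_integrable_imp_integrable) (use sq in simp_all)
  define Y where "Y i \<omega> = X i \<omega> / s" for i \<omega>
  interpret Y: iid_sequence M Y
  proof
    show "indep_vars (\<lambda>_. borel) Y UNIV"
      unfolding Y_def by (rule indep_vars_compose2[OF indep]) simp
    have "distr M borel (Y i) = distr (distr M borel (X i)) borel (\<lambda>x. x / s)" for i
      unfolding Y_def by (subst distr_distr) (simp_all add: comp_def)
    then show "distr M borel (Y i) = distr M borel (Y 0)" for i
      by (simp add: ident[of i])
    show "integrable M (Y 0)"
      unfolding Y_def using int0 by simp
  qed
  have S_eq: "Y.S k \<omega> = (\<Sum>i<k. X i \<omega>) / s" for k \<omega>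
    by (simp add: Y.S_def Y_def sum_divide_distrib)
  have "\<bar>measure (Y.cpois rate) {a / s..b / s} - (Phi (b / s) - Phi (a / s))\<bar>
      \<le> 7 * (rate * (\<integral>y. min (y\<^sup>2) (\<bar>y\<bar> ^ 3) \<partial>Y.law))"
  proof (rule Y.cpois_normal_approximation[OF rate])
    show "integrable Y.law (\<lambda>y. y\<^sup>2)"
      using sq by (subst Y.integrable_law[of _ 0]) (simp_all add: Y_def power_divide)
    show "(\<integral>y. y \<partial>Y.law) = 0"
      using mean by (subst Y.integral_law[of _ 0]) (simp_all add: Y_def[abs_def])
    show "rate * (\<integral>y. y\<^sup>2 \<partial>Y.law) = 1"
      using var \<open>0 < \<sigma>\<close> rate
      by (subst Y.integral_law[of _ 0]) (simp_all add: Y_def power_divide s_def power_mult_distrib)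
    show "a / s \<le> b / s" using s \<open>a \<le> b\<close> by (simp add: divide_right_mono)
  qed
  also have "(\<integral>y. min (y\<^sup>2) (\<bar>y\<bar> ^ 3) \<partial>Y.law) = (\<integral>\<omega>. min ((X 0 \<omega> / s)\<^sup>2) (\<bar>X 0 \<omega> / s\<bar> ^ 3) \<partial>M)"
    by (subst Y.integral_law[of _ 0]) (simp_all add: Y_def)
  also have "measure (Y.cpois rate) {a / s..b / s}
      = (\<integral>k. measure M {\<omega> \<in> space M. a \<le> (\<Sum>i<k. X i \<omega>) \<and> (\<Sum>i<k. X i \<omega>) \<le> b}
        \<partial>measure_pmf (poisson_pmf rate))"
    unfolding Y.measure_cpois_Icc S_eq using s by (simp add: divide_le_cancel)
  finally show ?thesis .
qed

subsection \<open>Gamma mixtures\<close>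

lemma gamma_kernel_bochner:
  fixes a :: real
  assumes "0 < a"
  shows "has_bochner_integral lborel
    (\<lambda>l. indicator {0<..} l * (l powr (a - 1) * exp (- l))) (Gamma a)"
proof -
  let ?f = "\<lambda>t::real. t powr (a - 1) / exp t"
  have "(?f has_integral Gamma a) {0..}"
    by (rule Gamma_integral_real[OF assms])
  then have hi: "(?f has_integral Gamma a) {0<..}"
    by (subst has_integral_spike_set_eq[where T = "{0..}"])
      (auto intro: negligible_subset[of "{0}"])
  have "?f absolutely_integrable_on {0<..}"
    by (intro nonnegative_absolutely_integrable_1) (use hi in auto)
  then have int: "set_integrable lborel {0<..} ?f"
    unfolding set_integrable_def by (subst (asm) integrable_completion) auto
  have "(LINT t:{0<..}|lborel. ?f t) = Gamma a"
    using set_borel_integral_eq_integral(2)[OF int] hi by (simp add: integral_unique)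
  with int have "has_bochner_integral lborel (\<lambda>l. indicator {0<..} l *\<^sub>R ?f l) (Gamma a)"
    by (simp add: has_bochner_integral_iff set_integrable_def set_lebesgue_integral_def)
  then show ?thesis by (simp add: exp_minus divide_inverse)
qed

lemma gamma_kernel_scaled:
  fixes a b :: real
  assumes a: "0 < a" and b: "0 < b"
  shows "has_bochner_integral lborel
    (\<lambda>l. indicator {0<..} l * (l powr (a - 1) * exp (- (b * l)))) (Gamma a * (1 / b) powr a)"
proof -
  have "has_bochner_integral lborel
      (\<lambda>l. indicator {0<..} (0 + b * l) * ((0 + b * l) powr (a - 1) * exp (- (0 + b * l))))
      (Gamma a /\<^sub>R \<bar>b\<bar>)"
    using b gamma_kernel_bochner[OF a]
    by (intro lborel_has_bochner_integral_real_affine_iff[THEN iffD1]) simp_all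
  then have "has_bochner_integral lborel
      (\<lambda>l. b powr (1 - a) * (indicator {0<..} (0 + b * l)
        * ((0 + b * l) powr (a - 1) * exp (- (0 + b * l)))))
      (b powr (1 - a) * (Gamma a /\<^sub>R \<bar>b\<bar>))"
    by (rule has_bochner_integral_mult_right)
  moreover have "b powr (1 - a) * (indicator {0<..} (0 + b * l)
        * ((0 + b * l) powr (a - 1) * exp (- (0 + b * l))))
      = indicator {0<..} l * (l powr (a - 1) * exp (- (b * l)))" for l :: real
  proof (cases "0 < l")
    case True
    have "b powr (1 - a) * (b * l) powr (a - 1) = b powr (1 - a) * b powr (a - 1) * l powr (a - 1)"
      using b True by (simp add: powr_mult)
    also have "b powr (1 - a) * b powr (a - 1) = 1"
      using b by (simp add: powr_add[symmetric])
    finally show ?thesis using b True by simp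
  next
    case False
    then have "\<not> 0 < b * l" using b by (simp add: zero_less_mult_iff)
    then show ?thesis using False by simp
  qed
  moreover have "b powr (1 - a) * (Gamma a /\<^sub>R \<bar>b\<bar>) = Gamma a * (1 / b) powr a"
    using b by (simp add: powr_diff powr_divide field_simps)
  ultimately show ?thesis by (simp only:)
qed

section \<open>The Gamma law as mixing measure\<close>

definition gamma_measure :: "real \<Rightarrow> real measure" where
  "gamma_measure r =
    density lborel (\<lambda>l. ennreal (indicator {0<..} l * (l powr (r - 1) * exp (- l)) / Gamma r))"

lemma sets_gamma_measure [measurable_cong, simp]: "sets (gamma_measure r) = sets borel"
  by (simp add: gamma_measure_def)

lemma space_gamma_measure [simp]: "space (gamma_measure r) = UNIV"
  by (simp add: gamma_measure_def)

lemma AE_gamma_measure_pos: "AE l in gamma_measure r. 0 < l"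
  unfolding gamma_measure_def by (subst AE_density) (auto simp: indicator_def)

lemma integral_gamma_measure:
  fixes h :: "real \<Rightarrow> real"
  assumes "0 < r" and [measurable]: "h \<in> borel_measurable borel"
  shows "(\<integral>l. h l \<partial>gamma_measure r)
    = (\<integral>l. indicator {0<..} l * (l powr (r - 1) * exp (- l)) * h l \<partial>lborel) / Gamma r"
proof -
  have G: "0 < Gamma r" using assms by (simp add: Gamma_real_pos)
  have "(\<integral>l. h l \<partial>gamma_measure r)
      = (\<integral>l. (indicator {0<..} l * (l powr (r - 1) * exp (- l)) / Gamma r) *\<^sub>R h l \<partial>lborel)"
    unfolding gamma_measure_def using G by (intro integral_density) auto
  also have "\<dots> = (\<integral>l. indicator {0<..} l * (l powr (r - 1) * exp (- l)) * h l / Gamma r \<partial>lborel)"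
    by simp
  finally show ?thesis by simp
qed

lemma has_bochner_integral_gamma_measure:
  fixes h :: "real \<Rightarrow> real"
  assumes "0 < r" and [measurable]: "h \<in> borel_measurable borel"
    and "has_bochner_integral lborel
      (\<lambda>l. indicator {0<..} l * (l powr (r - 1) * exp (- l)) * h l) c"
  shows "has_bochner_integral (gamma_measure r) h (c / Gamma r)"
proof -
  have G: "0 < Gamma r" using assms by (simp add: Gamma_real_pos)
  have "has_bochner_integral lborel
      (\<lambda>l. indicator {0<..} l * (l powr (r - 1) * exp (- l)) * h l / Gamma r) (c / Gamma r)"
    by (intro has_bochner_integral_divide assms)
  then have "has_bochner_integral lborel
      (\<lambda>l. (indicator {0<..} l * (l powr (r - 1) * exp (- l)) / Gamma r) *\<^sub>R h l) (c / Gamma r)"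
    by simp
  then show ?thesis
    unfolding gamma_measure_def using G by (intro has_bochner_integral_density) auto
qed

lemma prob_space_gamma_measure:
  assumes "0 < r"
  shows "prob_space (gamma_measure r)"
proof
  have "0 < Gamma r" using assms by (simp add: Gamma_real_pos)
  have "has_bochner_integral (gamma_measure r) (\<lambda>_. 1) (Gamma r / Gamma r)"
    using assms gamma_kernel_bochner[OF assms] by (intro has_bochner_integral_gamma_measure) auto
  then have "integrable (gamma_measure r) (\<lambda>_. 1 :: real)" "(\<integral>l. 1 \<partial>gamma_measure r) = (1 :: real)"
    using \<open>0 < Gamma r\<close> by (auto simp: has_bochner_integral_iff)
  then have "(\<integral>\<^sup>+l. ennreal 1 \<partial>gamma_measure r) = ennreal 1"
    by (subst nn_integral_eq_integral) auto
  then show "emeasure (gamma_measure r) (space (gamma_measure r)) = 1"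
    by simp
qed

lemma gamma_measure_atMost:
  assumes "0 < r"
  shows "(\<integral>l. indicator {..c} l \<partial>gamma_measure r) = lower_inc_Gamma r c / Gamma r"
proof -
  have "(\<integral>l. indicator {0<..} l * (l powr (r - 1) * exp (- l)) * indicator {..c} l \<partial>lborel)
      = lower_inc_Gamma r c"
    unfolding lower_inc_Gamma_def set_lebesgue_integral_def
    by (intro Bochner_Integration.integral_cong) (auto simp: indicator_def)
  then show ?thesis
    using assms by (subst integral_gamma_measure) auto
qed

text \<open>The factor 1 / sqrt l lowers the shape by 1/2. The new shape may be zero or negative, so
  the integral is cut off at a positive \<open>c\<close>.\<close>

lemma gamma_measure_atLeast:
  assumes "0 < r" "0 < c"
  shows "(\<integral>l. indicator {c..} l / sqrt l \<partial>gamma_measure r)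
    = upper_inc_Gamma (r - 1 / 2) c / Gamma r"
proof -
  have "indicator {0<..} l * (l powr (r - 1) * exp (- l)) * (indicator {c..} l / sqrt l)
      = indicator {c..} l *\<^sub>R (l powr (r - 1 / 2 - 1) * exp (- l))" for l
  proof (cases "c \<le> l")
    case True
    then have "0 < l" using assms by simp
    then have "l powr (r - 1 / 2 - 1) = l powr (r - 1) / sqrt l"
      by (simp add: powr_half_sqrt[symmetric] powr_diff[symmetric] algebra_simps)
    then show ?thesis using True \<open>0 < l\<close> by simp
  qed simp
  then have "(\<integral>l. indicator {0<..} l * (l powr (r - 1) * exp (- l)) * (indicator {c..} l / sqrt l) \<partial>lborel)
      = upper_inc_Gamma (r - 1 / 2) c"
    unfolding upper_inc_Gamma_def set_lebesgue_integral_def by simp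
  then show ?thesis
    using assms by (subst integral_gamma_measure) auto
qed

text \<open>Made total by 0 for nonpositive means: as an explicit function of the mean it is
  measurable on the whole line, and it agrees with \<open>poisson_pmf\<close> wherever the Gamma law
  has mass.\<close>

definition poisson_weight :: "real \<Rightarrow> nat \<Rightarrow> real" where
  "poisson_weight m k = (if 0 < m then m ^ k / fact k * exp (- m) else 0)"

lemma poisson_weight_nonneg: "0 \<le> poisson_weight m k"
  by (simp add: poisson_weight_def)

lemma poisson_weight_eq_pmf: "0 < m \<Longrightarrow> poisson_weight m k = pmf (poisson_pmf m) k"
  by (simp add: poisson_weight_def)

lemma poisson_weight_measurable [measurable]:
  "(\<lambda>l. poisson_weight (c * l) k) \<in> borel_measurable borel"
  unfolding poisson_weight_def by measurable

definition neg_binomial_weight :: "real \<Rightarrow> real \<Rightarrow> nat \<Rightarrow> real" where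
  "neg_binomial_weight r n k =
    Gamma (r + real k) / (Gamma r * fact k) * (1 / (1 + n)) powr r * (n / (1 + n)) ^ k"

text \<open>Multiplying the Gamma density by the Poisson weight gives again a Gamma kernel, of shape
  r + k and rate 1 + n.\<close>

lemma gamma_mixture_weight:
  assumes r: "0 < r" and n: "0 < n"
  shows "has_bochner_integral (gamma_measure r) (\<lambda>l. poisson_weight (n * l) k)
    (neg_binomial_weight r n k)"
proof -
  have "has_bochner_integral lborel
      (\<lambda>l. n ^ k / fact k * (indicator {0<..} l * (l powr (r + real k - 1) * exp (- ((1 + n) * l)))))
      (n ^ k / fact k * (Gamma (r + real k) * (1 / (1 + n)) powr (r + real k)))"
    using r n by (intro has_bochner_integral_mult_right gamma_kernel_scaled) auto
  moreover have "n ^ k / fact k * (indicator {0<..} l * (l powr (r + real k - 1) * exp (- ((1 + n) * l))))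
      = indicator {0<..} l * (l powr (r - 1) * exp (- l)) * poisson_weight (n * l) k" for l
  proof (cases "0 < l")
    case True
    have "l powr (r + real k - 1) = l powr ((r - 1) + real k)" by (simp add: algebra_simps)
    also have "\<dots> = l powr (r - 1) * l ^ k"
      using True by (simp only: powr_add powr_realpow)
    finally show ?thesis
      using True n
      by (simp add: poisson_weight_def power_mult_distrib exp_add[symmetric] algebra_simps
          mult_exp_exp)
  qed (simp add: indicator_def)
  ultimately have "has_bochner_integral lborel
      (\<lambda>l. indicator {0<..} l * (l powr (r - 1) * exp (- l)) * poisson_weight (n * l) k)
      (n ^ k / fact k * (Gamma (r + real k) * (1 / (1 + n)) powr (r + real k)))"
    by simp
  from has_bochner_integral_gamma_measure[OF r _ this]
  have "has_bochner_integral (gamma_measure r) (\<lambda>l. poisson_weight (n * l) k)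
    (n ^ k / fact k * (Gamma (r + real k) * (1 / (1 + n)) powr (r + real k)) / Gamma r)"
    by simp
  moreover have "n ^ k / fact k * (Gamma (r + real k) * (1 / (1 + n)) powr (r + real k)) / Gamma r
      = neg_binomial_weight r n k"
  proof -
    have "(1 / (1 + n)) powr (r + real k) = (1 / (1 + n)) powr r * (1 / (1 + n)) ^ k"
      using n by (simp only: powr_add) (simp add: powr_realpow)
    then show ?thesis
      by (simp add: neg_binomial_weight_def power_divide mult.commute mult.left_commute)
  qed
  ultimately show ?thesis by simp
qed

text \<open>\<open>H\<close> is a series of measurable functions of \<open>l\<close>, hence can be
  integrated; it coincides with the Poisson expectation \<open>F\<close> on the positive half-line.
  Sum and integral may be exchanged because the mixed weights are summable and \<open>q\<close>
  takes values between 0 and 1.\<close>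

lemma gamma_mixture:
  assumes r: "0 < r" and n: "0 < n" and q: "\<And>k. 0 \<le> q k" "\<And>k. q k \<le> 1"
    and summable: "summable (neg_binomial_weight r n)"
  defines "F \<equiv> \<lambda>l. \<integral>k. q k \<partial>measure_pmf (poisson_pmf (n * l))"
  defines "H \<equiv> \<lambda>l. \<Sum>k. poisson_weight (n * l) k * q k"
  shows "integrable (gamma_measure r) H"
    and "(\<lambda>k. neg_binomial_weight r n k * q k) sums (\<integral>l. H l \<partial>gamma_measure r)"
    and "\<And>l. 0 < l \<Longrightarrow> H l = F l"
proof -
  note mix = gamma_mixture_weight[OF r n]
  have int: "integrable (gamma_measure r) (\<lambda>l. poisson_weight (n * l) k * q k)" for k
    using mix[of k] by (intro integrable_mult_left) (simp add: has_bochner_integral_iff)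
  have val: "(\<integral>l. poisson_weight (n * l) k * q k \<partial>gamma_measure r) = neg_binomial_weight r n k * q k" for k
    using mix[of k] by (simp add: has_bochner_integral_iff)
  have nw: "0 \<le> neg_binomial_weight r n k" for k
    using r n unfolding neg_binomial_weight_def by (simp add: Gamma_real_pos less_imp_le)
  have sums: "(\<lambda>k. poisson_weight (n * l) k * q k) sums F l" if "0 < l" for l
  proof -
    have "integrable (measure_pmf (poisson_pmf (n * l))) q"
      by (rule measure_pmf.integrable_const_bound[where B = 1]) (auto simp: q)
    from nat_pmf_sums_integral[OF this] show ?thesis
      using that n by (simp add: F_def poisson_weight_eq_pmf)
  qed
  then show "\<And>l. 0 < l \<Longrightarrow> H l = F l"
    by (simp add: H_def sums_iff)
  have AE: "AE l in gamma_measure r. summable (\<lambda>k. norm (poisson_weight (n * l) k * q k))"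
    using AE_gamma_measure_pos
  proof eventually_elim
    case (elim l)
    then show ?case
      using sums[of l] by (simp add: sums_iff poisson_weight_nonneg q abs_mult)
  qed
  have "summable (\<lambda>k. neg_binomial_weight r n k * q k)"
    by (rule summable_comparison_test_ev[OF _ summable])
      (auto simp: nw q abs_mult mult_left_le)
  moreover have "norm (poisson_weight (n * l) k * q k) = poisson_weight (n * l) k * q k" for l k
    by (simp add: poisson_weight_nonneg q)
  ultimately have S: "summable (\<lambda>k. \<integral>l. norm (poisson_weight (n * l) k * q k) \<partial>gamma_measure r)"
    by (simp only: val)
  show "integrable (gamma_measure r) H"
    unfolding H_def by (rule integrable_suminf[OF int AE S])
  show "(\<lambda>k. neg_binomial_weight r n k * q k) sums (\<integral>l. H l \<partial>gamma_measure r)"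
    unfolding H_def using sums_integral[OF int AE S] by (simp only: val)
qed

section \<open>Random sums decomposed by the value of their count\<close>

lemma (in prob_space) random_sum_sums:
  fixes X :: "nat \<Rightarrow> 'a \<Rightarrow> real" and N :: "'a \<Rightarrow> nat"
  assumes indep: "indep_var2 (count_space UNIV) N (PiM UNIV (\<lambda>_. borel)) (\<lambda>\<omega> i. X i \<omega>)"
    and A [measurable]: "A \<in> sets borel"
  shows "(\<lambda>k. prob {\<omega> \<in> space M. N \<omega> = k} * prob {\<omega> \<in> space M. (\<Sum>i<k. X i \<omega>) \<in> A}) sums
    prob {\<omega> \<in> space M. (\<Sum>i<N \<omega>. X i \<omega>) \<in> A}"
proof -
  have N [measurable]: "N \<in> measurable M (count_space UNIV)"
    and Xs: "(\<lambda>\<omega> i. X i \<omega>) \<in> measurable M (PiM UNIV (\<lambda>_. borel))"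
    using indep by (auto simp: indep_var2_def)
  have [measurable]: "X i \<in> borel_measurable M" for i
    using measurable_compose[OF Xs measurable_component_singleton[of i]] by simp
  define E where "E k = {\<omega> \<in> space M. N \<omega> = k \<and> (\<Sum>i<k. X i \<omega>) \<in> A}" for k
  have prob_E: "prob (E k) = prob {\<omega> \<in> space M. N \<omega> = k} * prob {\<omega> \<in> space M. (\<Sum>i<k. X i \<omega>) \<in> A}" for k
  proof -
    \<comment> \<open>An event in sequence space depending on the first \<open>k\<close>
      coordinates, so that independence of \<open>N\<close> from the whole sequence applies to
      it.\<close>
    define B where "B = {f \<in> space (PiM UNIV (\<lambda>_::nat. borel :: real measure)). (\<Sum>i<k. f i) \<in> A}"
    have B: "B \<in> sets (PiM UNIV (\<lambda>_. borel))"
      unfolding B_def by measurable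
    have "{\<omega> \<in> space M. (\<Sum>i<k. X i \<omega>) \<in> A} = (\<lambda>\<omega> i. X i \<omega>) -` B \<inter> space M"
      by (auto simp: B_def space_PiM)
    moreover have "{\<omega> \<in> space M. N \<omega> = k} = N -` {k} \<inter> space M" by auto
    moreover have "prob ((N -` {k} \<inter> space M) \<inter> ((\<lambda>\<omega> i. X i \<omega>) -` B \<inter> space M))
        = prob (N -` {k} \<inter> space M) * prob ((\<lambda>\<omega> i. X i \<omega>) -` B \<inter> space M)"
    proof (rule indep_setD)
      show "indep_set {N -` S \<inter> space M | S. S \<in> sets (count_space UNIV)}
          {(\<lambda>\<omega> i. X i \<omega>) -` S \<inter> space M | S. S \<in> sets (PiM UNIV (\<lambda>_. borel))}"
        using indep unfolding indep_var2_def by blast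
    qed (use B in auto)
    ultimately have "prob ({\<omega> \<in> space M. N \<omega> = k} \<inter> {\<omega> \<in> space M. (\<Sum>i<k. X i \<omega>) \<in> A})
        = prob {\<omega> \<in> space M. N \<omega> = k} * prob {\<omega> \<in> space M. (\<Sum>i<k. X i \<omega>) \<in> A}"
      by simp
    moreover have "E k = {\<omega> \<in> space M. N \<omega> = k} \<inter> {\<omega> \<in> space M. (\<Sum>i<k. X i \<omega>) \<in> A}"
      by (auto simp: E_def)
    ultimately show ?thesis by simp
  qed
  have "(\<lambda>k. prob (E k)) sums prob (\<Union>k. E k)"
    by (rule finite_measure_UNION) (auto simp: E_def disjoint_family_on_def)
  also have "(\<Union>k. E k) = {\<omega> \<in> space M. (\<Sum>i<N \<omega>. X i \<omega>) \<in> A}"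
    by (auto simp: E_def)
  finally show ?thesis unfolding prob_E .
qed

lemma (in prob_space) summable_prob_nat:
  fixes N :: "'a \<Rightarrow> nat"
  assumes [measurable]: "N \<in> measurable M (count_space UNIV)"
  shows "summable (\<lambda>k. prob {\<omega> \<in> space M. N \<omega> = k})"
proof -
  have "(\<lambda>k. prob {\<omega> \<in> space M. N \<omega> = k}) sums prob (\<Union>k. {\<omega> \<in> space M. N \<omega> = k})"
    by (rule finite_measure_UNION) (auto simp: disjoint_family_on_def)
  then show ?thesis by (rule sums_summable)
qed

text \<open>The threshold for \<open>l\<close> is where |x| = \<sigma> sqrt(n l), that is, where the
  normalised jump has size 1. Both branches include the threshold, matching the closed endpoints in
  both incomplete Gamma functions; counting it twice only enlarges an upper bound.\<close>

definition gauss_error :: "real \<Rightarrow> real \<Rightarrow> real \<Rightarrow> real \<Rightarrow> real" where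
  "gauss_error \<sigma> n x l =
    (if l \<le> x\<^sup>2 / (n * \<sigma>\<^sup>2) then x\<^sup>2 else 0) / \<sigma>\<^sup>2
    + (if x\<^sup>2 / (n * \<sigma>\<^sup>2) \<le> l then \<bar>x\<bar> ^ 3 / sqrt l else 0) / (\<sigma> ^ 3 * sqrt n)"

lemma truncated_moment_le:
  fixes x l n \<sigma> :: real
  assumes "0 < l" "0 < n" "0 < \<sigma>"
  defines "s \<equiv> \<sigma> * sqrt (n * l)"
  shows "n * l * min ((x / s)\<^sup>2) (\<bar>x / s\<bar> ^ 3) \<le> gauss_error \<sigma> n x l"
proof (cases "l \<le> x\<^sup>2 / (n * \<sigma>\<^sup>2)")
  case True
  have "n * l * min ((x / s)\<^sup>2) (\<bar>x / s\<bar> ^ 3) \<le> n * l * (x / s)\<^sup>2"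
    using assms by (intro mult_left_mono) auto
  also have "\<dots> = x\<^sup>2 / \<sigma>\<^sup>2"
    using assms by (simp add: s_def power_divide power_mult_distrib)
  also have "\<dots> \<le> gauss_error \<sigma> n x l"
    using True assms by (simp add: gauss_error_def)
  finally show ?thesis .
next
  case False
  have "n * l * min ((x / s)\<^sup>2) (\<bar>x / s\<bar> ^ 3) \<le> n * l * \<bar>x / s\<bar> ^ 3"
    using assms by (intro mult_left_mono) auto
  also have "n * l * \<bar>x / s\<bar> ^ 3 = n * l * (\<bar>x\<bar> ^ 3 / (\<sigma> ^ 3 * (n * l * sqrt (n * l))))"
  proof -
    have "sqrt (n * l) ^ 3 = n * l * sqrt (n * l)"
      using assms unfolding power3_eq_cube by simp
    then have "s ^ 3 = \<sigma> ^ 3 * (n * l * sqrt (n * l))"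
      by (simp only: s_def power_mult_distrib)
    moreover have "0 < s" using assms by (simp add: s_def)
    ultimately show ?thesis by (simp add: power_divide)
  qed
  also have "\<dots> = (\<bar>x\<bar> ^ 3 / sqrt l) / (\<sigma> ^ 3 * sqrt n)"
    using assms by (simp add: real_sqrt_mult field_simps)
  also have "\<dots> = gauss_error \<sigma> n x l"
    using False by (simp add: gauss_error_def)
  finally show ?thesis .
qed

text \<open>In the cubic regime |x| / sqrt l is at most \<sigma> sqrt n. This gives a
  square-integrable-type majorant C x^2, so that Fubini applies without a third moment.\<close>

lemma cubic_tail_le:
  fixes x l n \<sigma> :: real
  assumes "0 < l" "0 < n" "0 < \<sigma>" "x\<^sup>2 / (n * \<sigma>\<^sup>2) \<le> l"
  shows "\<bar>x\<bar> ^ 3 / sqrt l \<le> \<sigma> * sqrt n * x\<^sup>2"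
proof -
  have "sqrt (x\<^sup>2 / (n * \<sigma>\<^sup>2)) \<le> sqrt l" using assms by simp
  then have "\<bar>x\<bar> \<le> \<sigma> * sqrt n * sqrt l"
    using assms by (simp add: real_sqrt_divide real_sqrt_mult field_simps)
  then have "\<bar>x\<bar> / sqrt l \<le> \<sigma> * sqrt n"
    using assms by (simp add: divide_le_eq)
  then have "x\<^sup>2 * (\<bar>x\<bar> / sqrt l) \<le> x\<^sup>2 * (\<sigma> * sqrt n)"
    by (intro mult_left_mono) auto
  moreover have "\<bar>x\<bar> ^ 3 = x\<^sup>2 * \<bar>x\<bar>" by (simp add: power3_eq_cube power2_eq_square)
  ultimately show ?thesis by (simp add: mult.commute)
qed

lemma gauss_error_mixture:
  fixes X :: "'a \<Rightarrow> real" and n \<sigma> r :: real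
  assumes "prob_space M" and X [measurable]: "X \<in> borel_measurable M"
    and sq: "integrable M (\<lambda>\<omega>. (X \<omega>)\<^sup>2)"
    and r: "0 < r" and n: "0 < n" and \<sigma>: "0 < \<sigma>"
  shows "integrable (gamma_measure r) (\<lambda>l. \<integral>\<omega>. gauss_error \<sigma> n (X \<omega>) l \<partial>M)" (is ?int)
    and "(\<integral>l. (\<integral>\<omega>. gauss_error \<sigma> n (X \<omega>) l \<partial>M) \<partial>gamma_measure r) =
      1 / (\<sigma>\<^sup>2 * Gamma r) *
        ((\<integral>\<omega>. (X \<omega>)\<^sup>2 * lower_inc_Gamma r ((X \<omega>)\<^sup>2 / (n * \<sigma>\<^sup>2)) \<partial>M)
        + 1 / (\<sigma> * sqrt n) *
          (\<integral>\<omega>. \<bar>X \<omega>\<bar> ^ 3 * upper_inc_Gamma (r - 1 / 2) ((X \<omega>)\<^sup>2 / (n * \<sigma>\<^sup>2)) \<partial>M))" (is ?eq)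
    and "0 < l \<Longrightarrow> integrable M (\<lambda>\<omega>. gauss_error \<sigma> n (X \<omega>) l)"
proof -
  interpret prob_space M by fact
  let ?G = "gamma_measure r"
  interpret G: prob_space ?G by (rule prob_space_gamma_measure[OF r])
  interpret P: pair_sigma_finite M ?G ..
  define c where "c \<omega> = (X \<omega>)\<^sup>2 / (n * \<sigma>\<^sup>2)" for \<omega>
  have [measurable]: "c \<in> borel_measurable M" unfolding c_def by measurable
  define a1 where "a1 \<omega> l = (if l \<le> c \<omega> then (X \<omega>)\<^sup>2 else 0)" for \<omega> l
  define a2 where "a2 \<omega> l = (if c \<omega> \<le> l then \<bar>X \<omega>\<bar> ^ 3 / sqrt l else 0)" for \<omega> l
  have ge: "gauss_error \<sigma> n (X \<omega>) l = a1 \<omega> l / \<sigma>\<^sup>2 + a2 \<omega> l / (\<sigma> ^ 3 * sqrt n)" for \<omega> l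
    by (simp add: gauss_error_def a1_def a2_def c_def)
  have b1: "\<bar>a1 \<omega> l\<bar> \<le> (X \<omega>)\<^sup>2" for \<omega> l by (simp add: a1_def)
  have b2: "\<bar>a2 \<omega> l\<bar> \<le> \<sigma> * sqrt n * (X \<omega>)\<^sup>2" if "0 < l" for \<omega> l
    using cubic_tail_le[OF that n \<sigma>, of "X \<omega>"] n \<sigma> that by (simp add: a2_def c_def)
  have dom: "integrable (M \<Otimes>\<^sub>M ?G) (\<lambda>z. C * (X (fst z))\<^sup>2)" for C
    using sq by (intro P.Fubini_integrable) (simp_all add: abs_mult G.prob_space)
  have m1 [measurable]: "(\<lambda>z. a1 (fst z) (snd z)) \<in> borel_measurable (M \<Otimes>\<^sub>M ?G)"
    unfolding a1_def by measurable
  have m2 [measurable]: "(\<lambda>z. a2 (fst z) (snd z)) \<in> borel_measurable (M \<Otimes>\<^sub>M ?G)"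
    unfolding a2_def by measurable
  have "AE z in M \<Otimes>\<^sub>M ?G. 0 < snd z"
  proof (rule P.AE_pair_measure)
    show "{z \<in> space (M \<Otimes>\<^sub>M ?G). 0 < snd z} \<in> sets (M \<Otimes>\<^sub>M ?G)" by measurable
  qed (use AE_gamma_measure_pos in auto)
  then have "AE z in M \<Otimes>\<^sub>M ?G. norm (a2 (fst z) (snd z)) \<le> norm (\<sigma> * sqrt n * (X (fst z))\<^sup>2)"
    by eventually_elim (use b2 n \<sigma> in \<open>simp add: abs_mult\<close>)
  then have "integrable (M \<Otimes>\<^sub>M ?G) (\<lambda>z. a2 (fst z) (snd z))"
    by (rule Bochner_Integration.integrable_bound[OF dom m2])
  then have i2: "integrable (M \<Otimes>\<^sub>M ?G) (\<lambda>(\<omega>, l). a2 \<omega> l)" by (simp add: split_beta')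
  have "integrable (M \<Otimes>\<^sub>M ?G) (\<lambda>z. a1 (fst z) (snd z))"
    by (rule Bochner_Integration.integrable_bound[OF dom[of 1] m1]) (use b1 in auto)
  then have i1: "integrable (M \<Otimes>\<^sub>M ?G) (\<lambda>(\<omega>, l). a1 \<omega> l)" by (simp add: split_beta')
  have s1: "integrable M (\<lambda>\<omega>. a1 \<omega> l)" for l
    by (rule Bochner_Integration.integrable_bound[OF sq]) (use b1 in \<open>auto simp: a1_def\<close>)
  have s2: "integrable M (\<lambda>\<omega>. a2 \<omega> l)" if "0 < l" for l
  proof (rule Bochner_Integration.integrable_bound)
    show "integrable M (\<lambda>\<omega>. \<sigma> * sqrt n * (X \<omega>)\<^sup>2)" using sq by simp
    show "AE \<omega> in M. norm (a2 \<omega> l) \<le> norm (\<sigma> * sqrt n * (X \<omega>)\<^sup>2)"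
      using b2[OF that] n \<sigma> by (simp add: abs_mult)
  qed (simp add: a2_def)
  show "integrable M (\<lambda>\<omega>. gauss_error \<sigma> n (X \<omega>) l)" if "0 < l"
    unfolding ge
    by (intro Bochner_Integration.integrable_add integrable_divide s1 s2 that)
  have split: "(\<integral>\<omega>. gauss_error \<sigma> n (X \<omega>) l \<partial>M)
      = (\<integral>\<omega>. a1 \<omega> l \<partial>M) / \<sigma>\<^sup>2 + (\<integral>\<omega>. a2 \<omega> l \<partial>M) / (\<sigma> ^ 3 * sqrt n)" if "0 < l" for l
    unfolding ge using s1[of l] s2[OF that] by simp
  have A1: "integrable ?G (\<lambda>l. \<integral>\<omega>. a1 \<omega> l \<partial>M)" by (rule P.integrable_snd[OF i1])
  have A2: "integrable ?G (\<lambda>l. \<integral>\<omega>. a2 \<omega> l \<partial>M)" by (rule P.integrable_snd[OF i2])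
  let ?H = "\<lambda>l. (\<integral>\<omega>. a1 \<omega> l \<partial>M) / \<sigma>\<^sup>2 + (\<integral>\<omega>. a2 \<omega> l \<partial>M) / (\<sigma> ^ 3 * sqrt n)"
  have H: "integrable ?G ?H"
    using A1 A2 by simp
  have meas: "(\<lambda>l. \<integral>\<omega>. gauss_error \<sigma> n (X \<omega>) l \<partial>M) \<in> borel_measurable ?G"
    unfolding ge a1_def a2_def by measurable
  have ae: "AE l in ?G. ?H l = (\<integral>\<omega>. gauss_error \<sigma> n (X \<omega>) l \<partial>M)"
    using AE_gamma_measure_pos by eventually_elim (simp only: split)
  show ?int
    by (rule integrable_cong_AE_imp[OF H meas]) (use ae in \<open>auto simp: eq_commute\<close>)
  have v1: "(\<integral>l. a1 \<omega> l \<partial>?G) = (X \<omega>)\<^sup>2 * lower_inc_Gamma r (c \<omega>) / Gamma r" for \<omega>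
  proof -
    have "(\<integral>l. a1 \<omega> l \<partial>?G) = (\<integral>l. (X \<omega>)\<^sup>2 * indicator {..c \<omega>} l \<partial>?G)"
      by (intro Bochner_Integration.integral_cong) (auto simp: a1_def)
    also have "\<dots> = (X \<omega>)\<^sup>2 * (\<integral>l. indicator {..c \<omega>} l \<partial>?G)"
      by (rule integral_mult_right_zero)
    finally show ?thesis by (simp only: gamma_measure_atMost[OF r] times_divide_eq_right)
  qed
  have v2: "(\<integral>l. a2 \<omega> l \<partial>?G) = \<bar>X \<omega>\<bar> ^ 3 * upper_inc_Gamma (r - 1 / 2) (c \<omega>) / Gamma r" for \<omega>
  \<comment> \<open>At X = 0 the cutoff is 0 and the upper incomplete Gamma integral may diverge;
    the cubic factor makes both sides 0, in accordance with the convention for this event.\<close>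
  proof (cases "X \<omega> = 0")
    case True
    then have "a2 \<omega> l = 0" for l by (simp add: a2_def)
    then show ?thesis using True by simp
  next
    case False
    then have c: "0 < c \<omega>" using n \<sigma> by (simp add: c_def)
    have "(\<integral>l. a2 \<omega> l \<partial>?G) = (\<integral>l. \<bar>X \<omega>\<bar> ^ 3 * (indicator {c \<omega>..} l / sqrt l) \<partial>?G)"
      by (intro Bochner_Integration.integral_cong) (auto simp: a2_def)
    also have "\<dots> = \<bar>X \<omega>\<bar> ^ 3 * (\<integral>l. indicator {c \<omega>..} l / sqrt l \<partial>?G)"
      by (rule integral_mult_right_zero)
    finally show ?thesis by (simp only: gamma_measure_atLeast[OF r c] times_divide_eq_right)
  qed
  have "(\<integral>l. (\<integral>\<omega>. gauss_error \<sigma> n (X \<omega>) l \<partial>M) \<partial>?G) = (\<integral>l. ?H l \<partial>?G)"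
    by (rule integral_cong_AE) (use meas H ae in \<open>auto simp: eq_commute\<close>)
  also have "\<dots> = (\<integral>l. (\<integral>\<omega>. a1 \<omega> l \<partial>M) \<partial>?G) / \<sigma>\<^sup>2
      + (\<integral>l. (\<integral>\<omega>. a2 \<omega> l \<partial>M) \<partial>?G) / (\<sigma> ^ 3 * sqrt n)"
    using A1 A2 by simp
  also have "(\<integral>l. (\<integral>\<omega>. a1 \<omega> l \<partial>M) \<partial>?G)
      = (\<integral>\<omega>. (X \<omega>)\<^sup>2 * lower_inc_Gamma r (c \<omega>) \<partial>M) / Gamma r"
    by (subst P.Fubini_integral[OF i1]) (simp only: v1 integral_divide_zero)
  also have "(\<integral>l. (\<integral>\<omega>. a2 \<omega> l \<partial>M) \<partial>?G)
      = (\<integral>\<omega>. \<bar>X \<omega>\<bar> ^ 3 * upper_inc_Gamma (r - 1 / 2) (c \<omega>) \<partial>M) / Gamma r"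
    by (subst P.Fubini_integral[OF i2]) (simp only: v2 integral_divide_zero)
  finally show ?eq
    unfolding c_def using \<sigma> by (simp add: divide_simps power3_eq_cube power2_eq_square algebra_simps)
qed

section \<open>The limit law as a Gamma mixture of centred normal windows\<close>

lemma folded_variance_gamma_cdf_mixture:
  assumes r: "0 < r" and "0 \<le> z" "0 < n" "0 < \<sigma>"
  defines "V \<equiv> \<lambda>l. 2 * Phi (z / (2 * (\<sigma> * sqrt (n * l)))) - 1"
  shows "(\<integral>l. V l \<partial>gamma_measure r) = folded_variance_gamma_cdf r (z / (2 * \<sigma> * sqrt n))"
    and "integrable (gamma_measure r) V"
proof -
  interpret G: prob_space "gamma_measure r" by (rule prob_space_gamma_measure[OF r])
  have [measurable]: "Phi \<in> borel_measurable borel"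
    by (intro borel_measurable_continuous_onI continuous_at_imp_continuous_on ballI isCont_Phi)
  have [measurable]: "V \<in> borel_measurable borel" unfolding V_def by measurable
  have "\<bar>V l\<bar> \<le> 1" for l
    unfolding V_def using Phi_le_1 Phi_ge_0 by (simp add: abs_le_iff)
  then show "integrable (gamma_measure r) V"
    by (intro G.integrable_const_bound[where B = 1]) auto
  have pointwise: "indicator {0<..} l * (l powr (r - 1) * exp (- l)) * V l
    = indicator {0<..} l *\<^sub>R (folded_normal_cdf (z / (2 * \<sigma> * sqrt n) / sqrt l) * l powr (r - 1) * exp (- l))" for l
  proof (cases "0 < l")
    case True
    have arg: "z / (2 * \<sigma> * sqrt n) / sqrt l = z / (2 * (\<sigma> * sqrt (n * l)))"
      by (simp add: real_sqrt_mult mult.assoc)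
    moreover have "0 \<le> z / (2 * (\<sigma> * sqrt (n * l)))" using assms True by simp
    then have "folded_normal_cdf (z / (2 * \<sigma> * sqrt n) / sqrt l) = V l"
      unfolding arg folded_normal_cdf_def V_def by (rule if_P)
    then show ?thesis by (simp only:) simp
  qed simp
  have "(\<integral>l. V l \<partial>gamma_measure r)
      = (\<integral>l. indicator {0<..} l * (l powr (r - 1) * exp (- l)) * V l \<partial>lborel) / Gamma r"
    by (rule integral_gamma_measure[OF r]) simp
  then show "(\<integral>l. V l \<partial>gamma_measure r) = folded_variance_gamma_cdf r (z / (2 * \<sigma> * sqrt n))"
    unfolding pointwise folded_variance_gamma_cdf_def set_lebesgue_integral_def by simp
qed

(* X 0, X 1, ... are X_1, X_2, ...; on {X_1 = 0} the last integrand is 0 because of its factor. *)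
theorem corollary5:
  fixes M :: "'a measure" and X :: "nat \<Rightarrow> 'a \<Rightarrow> real" and N :: "'a \<Rightarrow> nat"
    and \<sigma> r :: real and n :: nat
  assumes "prob_space M"
    and X_indep: "prob_space.indep_vars M (\<lambda>_. borel) X UNIV"
    and X_distrib: "\<And>i. distr M borel (X i) = distr M borel (X 0)"
    and X_mean: "prob_space.expectation M (X 0) = 0"
    and X_square_integrable: "integrable M (\<lambda>\<omega>. (X 0 \<omega>)\<^sup>2)"
    and X_second_moment: "prob_space.expectation M (\<lambda>\<omega>. (X 0 \<omega>)\<^sup>2) = \<sigma>\<^sup>2"
    and "0 < \<sigma>" and "0 < r" and "1 \<le> n"
    and N_distrib: "\<And>k. prob_space.prob M {\<omega> \<in> space M. N \<omega> = k} =
          Gamma (r + real k) / (Gamma r * fact k) *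
          (1 / (1 + real n)) powr r * (real n / (1 + real n)) ^ k"
    and N_X_indep: "prob_space.indep_var2 M (count_space UNIV) N
          (PiM UNIV (\<lambda>_. borel)) (\<lambda>\<omega> i. X i \<omega>)"
  shows "(SUP z\<in>{0..}. \<bar>conc_fun M (\<lambda>\<omega>. \<Sum>i<N \<omega>. X i \<omega>) z
            - folded_variance_gamma_cdf r (z / (2 * \<sigma> * sqrt (real n)))\<bar>)
         \<le> 7.4184 / (\<sigma>\<^sup>2 * Gamma r) *
            (prob_space.expectation M
               (\<lambda>\<omega>. (X 0 \<omega>)\<^sup>2 * lower_inc_Gamma r ((X 0 \<omega>)\<^sup>2 / (real n * \<sigma>\<^sup>2)))
             + 1 / (\<sigma> * sqrt (real n)) *
               prob_space.expectation M
                 (\<lambda>\<omega>. \<bar>X 0 \<omega>\<bar> ^ 3 * upper_inc_Gamma (r - 1 / 2) ((X 0 \<omega>)\<^sup>2 / (real n * \<sigma>\<^sup>2))))"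
proof -
  interpret prob_space M by fact
  let ?n = "real n" and ?G = "gamma_measure r"
  interpret G: prob_space ?G by (rule prob_space_gamma_measure) fact
  have n: "0 < ?n" using \<open>1 \<le> n\<close> by simp
  have [measurable]: "X i \<in> borel_measurable M" for i
    using X_indep by (auto simp: indep_vars_def)
  have N_meas: "N \<in> measurable M (count_space UNIV)"
    using N_X_indep by (simp add: indep_var2_def)
  have weight: "prob {\<omega> \<in> space M. N \<omega> = k} = neg_binomial_weight r ?n k" for k
    by (simp only: N_distrib neg_binomial_weight_def)
  have summable: "summable (neg_binomial_weight r ?n)"
    using summable_prob_nat[OF N_meas] by (simp only: weight)
  \<comment> \<open>This error bound contains neither the position nor the length of the window, so
    the supremum over positions can be taken after averaging over \<open>l\<close>.\<close>
  define L where "L l = (\<integral>\<omega>. gauss_error \<sigma> ?n (X 0 \<omega>) l \<partial>M)" for l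
  define T where "T = (\<integral>l. L l \<partial>?G)"
  note mix = gauss_error_mixture[OF \<open>prob_space M\<close> _ X_square_integrable \<open>0 < r\<close> n \<open>0 < \<sigma>\<close>]
  have L_int: "integrable ?G L"
    unfolding L_def by (rule mix(1)) simp
  define V where "V z = folded_variance_gamma_cdf r (z / (2 * \<sigma> * sqrt ?n))" for z
  define C where "C z l = 2 * Phi (z / (2 * (\<sigma> * sqrt (?n * l)))) - 1" for z l
  have V: "(\<integral>l. C z l \<partial>?G) = V z" and C_int: "integrable ?G (C z)" if "0 \<le> z" for z
    unfolding C_def V_def
    using folded_variance_gamma_cdf_mixture[OF \<open>0 < r\<close> that n \<open>0 < \<sigma>\<close>] by blast+
  define Q where "Q x z = prob {\<omega> \<in> space M. x \<le> (\<Sum>i<N \<omega>. X i \<omega>) \<and> (\<Sum>i<N \<omega>. X i \<omega>) \<le> x + z}"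
    for x z
  \<comment> \<open>\<open>H\<close> is the window probability conditional on \<open>l\<close>. Only
    its average and its distance from the normal window matter below, for an arbitrary position in
    \<open>upper\<close> and for the centred one in \<open>lower\<close>.\<close>
  have mixture: "\<exists>H. integrable ?G H \<and> Q x z = (\<integral>l. H l \<partial>?G) \<and>
      (\<forall>l>0. \<bar>H l - (Phi ((x + z) / (\<sigma> * sqrt (?n * l))) - Phi (x / (\<sigma> * sqrt (?n * l))))\<bar> \<le> 7 * L l)"
    if "0 \<le> z" for x z
  proof -
    define q where "q k = prob {\<omega> \<in> space M. x \<le> (\<Sum>i<k. X i \<omega>) \<and> (\<Sum>i<k. X i \<omega>) \<le> x + z}" for k
    let ?H = "\<lambda>l. \<Sum>k. poisson_weight (?n * l) k * q k"
    have q: "0 \<le> q k" "q k \<le> 1" for k by (simp_all add: q_def)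
    note g = gamma_mixture[OF \<open>0 < r\<close> n q summable]
    have "(\<lambda>k. neg_binomial_weight r ?n k * q k) sums Q x z"
      using random_sum_sums[OF N_X_indep, of "{x..x + z}"] by (simp add: weight q_def Q_def)
    then have Q_eq: "Q x z = (\<integral>l. ?H l \<partial>?G)"
      using g(2) by (rule sums_unique2)
    have H_bound: "\<bar>?H l - (Phi ((x + z) / (\<sigma> * sqrt (?n * l))) - Phi (x / (\<sigma> * sqrt (?n * l))))\<bar> \<le> 7 * L l"
      if "0 < l" for l
    proof -
      let ?s = "\<sigma> * sqrt (?n * l)"
      have rate: "0 < ?n * l" using n that by simp
      have "\<bar>?H l - (Phi ((x + z) / ?s) - Phi (x / ?s))\<bar>
          \<le> 7 * (?n * l * (\<integral>\<omega>. min ((X 0 \<omega> / ?s)\<^sup>2) (\<bar>X 0 \<omega> / ?s\<bar> ^ 3) \<partial>M))"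
        unfolding g(3)[OF that] unfolding q_def
        by (rule poisson_sum_normal_approximation[OF \<open>prob_space M\<close> X_indep X_distrib X_mean
              X_square_integrable X_second_moment \<open>0 < \<sigma>\<close> rate])
          (use \<open>0 \<le> z\<close> in simp)
      moreover have "(\<integral>\<omega>. ?n * l * min ((X 0 \<omega> / ?s)\<^sup>2) (\<bar>X 0 \<omega> / ?s\<bar> ^ 3) \<partial>M) \<le> L l"
        unfolding L_def
      proof (rule integral_mono)
        show "integrable M (\<lambda>\<omega>. ?n * l * min ((X 0 \<omega> / ?s)\<^sup>2) (\<bar>X 0 \<omega> / ?s\<bar> ^ 3))"
        proof (rule integrable_mult_right, rule Bochner_Integration.integrable_bound)
          show "integrable M (\<lambda>\<omega>. (X 0 \<omega> / ?s)\<^sup>2)"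
            using X_square_integrable by (simp add: power_divide)
        qed auto
        show "integrable M (\<lambda>\<omega>. gauss_error \<sigma> ?n (X 0 \<omega>) l)"
          using that by (intro mix(3)) simp_all
        fix \<omega>
        show "?n * l * min ((X 0 \<omega> / ?s)\<^sup>2) (\<bar>X 0 \<omega> / ?s\<bar> ^ 3) \<le> gauss_error \<sigma> ?n (X 0 \<omega>) l"
          by (rule truncated_moment_le[OF that n \<open>0 < \<sigma>\<close>])
      qed
      then have "7 * (?n * l * (\<integral>\<omega>. min ((X 0 \<omega> / ?s)\<^sup>2) (\<bar>X 0 \<omega> / ?s\<bar> ^ 3) \<partial>M)) \<le> 7 * L l"
        by (simp only: integral_mult_right_zero)
      ultimately show ?thesis by (rule order_trans)
    qed
    show ?thesis
      by (rule exI[of _ ?H]) (intro conjI allI impI g(1) Q_eq H_bound)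
  qed
  have upper: "Q x z \<le> V z + 7 * T" if "0 \<le> z" for x z
  proof -
    obtain H where H: "integrable ?G H" "Q x z = (\<integral>l. H l \<partial>?G)"
      "\<And>l. 0 < l \<Longrightarrow> \<bar>H l - (Phi ((x + z) / (\<sigma> * sqrt (?n * l))) - Phi (x / (\<sigma> * sqrt (?n * l))))\<bar> \<le> 7 * L l"
      using mixture[OF \<open>0 \<le> z\<close>, of x] by blast
    have "(\<integral>l. H l \<partial>?G) \<le> (\<integral>l. C z l + 7 * L l \<partial>?G)"
    proof (rule integral_mono_AE)
      show "integrable ?G (\<lambda>l. C z l + 7 * L l)"
        using C_int[OF \<open>0 \<le> z\<close>] L_int by simp
      show "AE l in ?G. H l \<le> C z l + 7 * L l"
        using AE_gamma_measure_pos
      proof eventually_elim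
        case (elim l)
        let ?s = "\<sigma> * sqrt (?n * l)"
        have s: "0 < ?s" using elim n \<open>0 < \<sigma>\<close> by simp
        have "Phi ((x + z) / ?s) - Phi (x / ?s) \<le> 2 * Phi (((x + z) / ?s - x / ?s) / 2) - 1"
          using s \<open>0 \<le> z\<close> by (intro Phi_interval_le_centred divide_right_mono) auto
        also have "((x + z) / ?s - x / ?s) / 2 = z / (2 * ?s)"
          by (simp add: diff_divide_distrib[symmetric])
        finally show ?case using H(3)[OF elim] by (simp add: C_def)
      qed
    qed fact
    also have "\<dots> = V z + 7 * T"
      using C_int[OF \<open>0 \<le> z\<close>] L_int V[OF \<open>0 \<le> z\<close>] by (simp add: T_def)
    finally show ?thesis using H(2) by simp
  qed
  \<comment> \<open>One good position suffices for a lower bound on a supremum: at x = -z/2 the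
    normal window probability equals \<open>C z l\<close> for every \<open>l\<close> at
    once.\<close>
  have lower: "V z - 7 * T \<le> Q (- z / 2) z" if "0 \<le> z" for z
  proof -
    obtain H where H: "integrable ?G H" "Q (- z / 2) z = (\<integral>l. H l \<partial>?G)"
      "\<And>l. 0 < l \<Longrightarrow> \<bar>H l - (Phi ((- z / 2 + z) / (\<sigma> * sqrt (?n * l))) - Phi (- z / 2 / (\<sigma> * sqrt (?n * l))))\<bar> \<le> 7 * L l"
      using mixture[OF \<open>0 \<le> z\<close>, of "- z / 2"] by blast
    have "V z - 7 * T = (\<integral>l. C z l - 7 * L l \<partial>?G)"
      using C_int[OF \<open>0 \<le> z\<close>] L_int V[OF \<open>0 \<le> z\<close>] by (simp add: T_def)
    also have "\<dots> \<le> (\<integral>l. H l \<partial>?G)"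
    proof (rule integral_mono_AE)
      show "integrable ?G (\<lambda>l. C z l - 7 * L l)"
        using C_int[OF \<open>0 \<le> z\<close>] L_int by simp
      show "AE l in ?G. C z l - 7 * L l \<le> H l"
        using AE_gamma_measure_pos
      proof eventually_elim
        case (elim l)
        let ?s = "\<sigma> * sqrt (?n * l)"
        have "(- z / 2 + z) / ?s = z / (2 * ?s)" "- z / 2 / ?s = - (z / (2 * ?s))"
          by simp_all
        then have "Phi ((- z / 2 + z) / ?s) - Phi (- z / 2 / ?s) = C z l"
          by (simp only: Phi_uminus C_def)
        then show ?case using H(3)[OF elim] by linarith
      qed
    qed fact
    finally show ?thesis using H(2) by simp
  qed
  have conc: "\<bar>conc_fun M (\<lambda>\<omega>. \<Sum>i<N \<omega>. X i \<omega>) z - V z\<bar> \<le> 7 * T" if "0 \<le> z" for z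
  proof -
    have eq: "conc_fun M (\<lambda>\<omega>. \<Sum>i<N \<omega>. X i \<omega>) z = (SUP x. Q x z)"
      by (simp add: conc_fun_def Q_def)
    have "bdd_above (range (\<lambda>x. Q x z))"
      by (rule bdd_aboveI2[where M = 1]) (simp add: Q_def)
    then have "Q (- z / 2) z \<le> (SUP x. Q x z)"
      by (rule cSUP_upper[OF UNIV_I])
    moreover have "(SUP x. Q x z) \<le> V z + 7 * T"
      by (rule cSUP_least) (use upper that in auto)
    ultimately show ?thesis
      using lower[OF that] unfolding eq by linarith
  qed
  \<comment> \<open>Nonnegativity comes for free, as \<open>7 * T\<close> bounds an absolute value;
    it permits enlarging the factor 7 to 7.4184.\<close>
  have "0 \<le> T"
    using conc[of 0] by linarith
  have "(SUP z\<in>{0..}. \<bar>conc_fun M (\<lambda>\<omega>. \<Sum>i<N \<omega>. X i \<omega>) z - V z\<bar>) \<le> 7.4184 * T"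
  proof (rule cSUP_least)
    fix z :: real assume "z \<in> {0..}"
    then show "\<bar>conc_fun M (\<lambda>\<omega>. \<Sum>i<N \<omega>. X i \<omega>) z - V z\<bar> \<le> 7.4184 * T"
      using conc[of z] \<open>0 \<le> T\<close> by simp
  qed simp
  then show ?thesis
    unfolding V_def T_def L_def mix(2)[OF \<open>X 0 \<in> borel_measurable M\<close>] by simp
qed

end
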